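(* Suppose $\max_{u\in\mathbb{R}}|f'(u)|<L$. Let $u^{n-1}\in P_M^0(\Omega)$ be given. If $\tau=|t_n-t_{n-1}|\le \varepsilon/L$, then the problem: find $h^n\in V_{M,N}^{n,u^{n-1}}$ such that $$\int_{t_{n-1}}^{t_n} (h^n_t,v_t)+\varepsilon(\nabla h^n,\nabla v_t)+\frac1\varepsilon (f(h^n),v_t)\,dt=0\qquad\forall\, v\in V_{M,N}^{n,u^{n-1}},$$ has a unique solution $h^n$, and this solution satisfies the discrete energy law $$E[h^n(x,t_n)]-E[h^n(x,t_{n-1})]=-\int_{t_{n-1}}^{t_n}(h^n_t,h^n_t)\,dt\le 0.$$
   Context: $\Omega\subset\mathbb{R}^d$ is a bounded domain with $C^{1,1}$ boundary or a convex polygonal domain; $(\cdot,\cdot)$ is the inner product of $L^2(\Omega)$; $\varepsilon>0$. $F:\mathbb{R}\to\mathbb{R}$ is a (double-well) potential and $f=F'$. The energy is $E(u)=\int_\Omega\left(\frac{\varepsilon}{2}|\nabla u|^2+\frac1\varepsilon F(u)\right)dx$. $P_M(\Omega)$ denotes the polynomials of degree at most $M$ on $\Omega$, and $P_M^0(\Omega)=\{u\in P_M(\Omega): u|_{\partial\Omega}=0\}$. $P_N([s,t])$ denotes the polynomials of degree at most $N$ (with $N\ge1$) in the time variable on $[s,t]$. With time grid points $t_n=n\tau$, define $$V_{M,N}^{n,u^{n-1}}=\{v\in P_M^0(\Omega)\otimes P_N([t_{n-1},t_n]) : v(x,t_{n-1})=u^{n-1}(x)\}.$$ The subscript $t$ denotes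 the time derivative. *)

theory Defs
  imports "HOL-Analysis.Analysis"
begin

subsection \<open>Domains\<close>

text \<open>
  Near each boundary point the domain is the region strictly above the graph of a \<open>C\<^sup>1\<^sup>,\<^sup>1\<close> function
  in suitable orthonormal coordinates. The direction \<open>e\<close> is the last coordinate axis, and a function
  of the remaining \<open>d - 1\<close> coordinates is a function \<open>\<gamma>\<close> evaluated at the orthogonal projection
  \<open>x - (x \<bullet> e) *\<^sub>R e\<close> of \<open>x\<close> onto the complement of \<open>e\<close>.
\<close>

definition C11_boundary :: "(real ^ 'd) set \<Rightarrow> bool" where
  "C11_boundary \<Omega> \<longleftrightarrow>
     (\<forall>x0 \<in> frontier \<Omega>. \<exists>r > 0. \<exists>e \<gamma> G K.
        norm e = 1 \<and>
        (\<forall>y. GDERIV \<gamma> y :> G y) \<and> K-lipschitz_on UNIV G \<and>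
        \<Omega> \<inter> ball x0 r = {x \<in> ball x0 r. \<gamma> (x - (x \<bullet> e) *\<^sub>R e) < x \<bullet> e})"

definition bounded_domain :: "(real ^ 'd) set \<Rightarrow> bool" where
  "bounded_domain \<Omega> \<longleftrightarrow> open \<Omega> \<and> connected \<Omega> \<and> \<Omega> \<noteq> {} \<and> bounded \<Omega>"

definition convex_polygonal :: "(real ^ 'd) set \<Rightarrow> bool" where
  "convex_polygonal \<Omega> \<longleftrightarrow> convex \<Omega> \<and> polytope (closure \<Omega>)"

definition admissible_domain :: "(real ^ 'd) set \<Rightarrow> bool" where
  "admissible_domain \<Omega> \<longleftrightarrow>
     bounded_domain \<Omega> \<and> (C11_boundary \<Omega> \<or> convex_polygonal \<Omega>)"


subsection \<open>Gradient, inner products and energy\<close>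

definition grad :: "(real ^ 'd \<Rightarrow> real) \<Rightarrow> real ^ 'd \<Rightarrow> real ^ 'd" where
  "grad u x = (THE D. GDERIV u x :> D)"

lemma grad_eqI:
  assumes "GDERIV u x :> D"
  shows "grad u x = D"
  unfolding grad_def
proof (rule the_equality)
  fix D' assume "GDERIV u x :> D'"
  with assms have "(\<lambda>h. h \<bullet> D') = (\<lambda>h. h \<bullet> D)"
    unfolding gderiv_def by (rule has_derivative_unique[rotated])
  then have "(D' - D) \<bullet> D' = (D' - D) \<bullet> D" by (rule fun_cong)
  then have "(D' - D) \<bullet> (D' - D) = 0" by (simp only: inner_diff_right)
  then show "D' = D" by simp
qed (fact assms)

text \<open>Used for scalar functions and for vector fields alike.\<close>

definition L2_inner ::
  "(real ^ 'd) set \<Rightarrow> (real ^ 'd \<Rightarrow> 'b::real_inner) \<Rightarrow> (real ^ 'd \<Rightarrow> 'b) \<Rightarrow> real" where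
  "L2_inner \<Omega> g k = (LINT x:\<Omega>|lborel. g x \<bullet> k x)"

definition energy ::
  "real \<Rightarrow> (real \<Rightarrow> real) \<Rightarrow> (real ^ 'd) set \<Rightarrow> (real ^ 'd \<Rightarrow> real) \<Rightarrow> real" where
  "energy \<epsilon> F \<Omega> u =
     (LINT x:\<Omega>|lborel. \<epsilon> / 2 * (norm (grad u x))\<^sup>2 + 1 / \<epsilon> * F (u x))"


subsection \<open>Polynomial spaces\<close>

text \<open>
  A polynomial on a nonempty open set or on a nondegenerate interval is identified with the unique
  polynomial function on the whole space (respectively on the real line) that extends it.
  The degree is the total degree; multi-indices are functions \<open>'d \<Rightarrow> nat\<close>.
\<close>

definition multi_indices :: "nat \<Rightarrow> ('d::finite \<Rightarrow> nat) set" where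
  "multi_indices M = {\<alpha>. (\<Sum>i\<in>UNIV. \<alpha> i) \<le> M}"

lemma finite_multi_indices: "finite (multi_indices M :: ('d::finite \<Rightarrow> nat) set)"
proof (rule finite_subset)
  show "multi_indices M \<subseteq> (UNIV :: 'd set) \<rightarrow>\<^sub>E {..M}"
  proof
    fix \<alpha> :: "'d \<Rightarrow> nat" assume "\<alpha> \<in> multi_indices M"
    moreover have "\<alpha> i \<le> (\<Sum>j\<in>UNIV. \<alpha> j)" for i
      by (rule member_le_sum) auto
    ultimately show "\<alpha> \<in> UNIV \<rightarrow>\<^sub>E {..M}"
      by (auto simp: multi_indices_def intro: order_trans)
  qed
  show "finite ((UNIV :: 'd set) \<rightarrow>\<^sub>E {..M})" by (intro finite_PiE) auto
qed

definition poly_space :: "nat \<Rightarrow> (real ^ 'd \<Rightarrow> real) set" where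
  "poly_space M =
     {p. \<exists>c. p = (\<lambda>x. \<Sum>\<alpha>\<in>multi_indices M. c \<alpha> * (\<Prod>i\<in>UNIV. (x $ i) ^ \<alpha> i))}"

definition poly_space0 :: "(real ^ 'd) set \<Rightarrow> nat \<Rightarrow> (real ^ 'd \<Rightarrow> real) set" where
  "poly_space0 \<Omega> M = {p \<in> poly_space M. \<forall>x \<in> frontier \<Omega>. p x = 0}"

text \<open>
  The tensor product with the polynomials of degree at most \<open>N\<close> in time; space-time functions take
  the time argument first.
\<close>

definition tensor_space ::
  "(real ^ 'd) set \<Rightarrow> nat \<Rightarrow> nat \<Rightarrow> (real \<Rightarrow> real ^ 'd \<Rightarrow> real) set" where
  "tensor_space \<Omega> M N =
     {v. \<exists>(m::nat) p q. (\<forall>j<m. p j \<in> poly_space0 \<Omega> M \<and> degree (q j) \<le> N) \<and>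
           v = (\<lambda>t x. \<Sum>j<m. p j x * poly (q j) t)}"

text \<open>The affine space of space-time polynomials with value \<open>u\<close> at time \<open>s\<close>.\<close>

definition trial_space ::
  "(real ^ 'd) set \<Rightarrow> nat \<Rightarrow> nat \<Rightarrow> real \<Rightarrow> (real ^ 'd \<Rightarrow> real) \<Rightarrow>
   (real \<Rightarrow> real ^ 'd \<Rightarrow> real) set" where
  "trial_space \<Omega> M N s u = {v \<in> tensor_space \<Omega> M N. \<forall>x \<in> \<Omega>. v s x = u x}"


subsection \<open>The space-time Galerkin problem\<close>

definition time_deriv ::
  "(real \<Rightarrow> real ^ 'd \<Rightarrow> real) \<Rightarrow> real \<Rightarrow> real ^ 'd \<Rightarrow> real" where
  "time_deriv v t x = deriv (\<lambda>s. v s x) t"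

definition galerkin_solution ::
  "real \<Rightarrow> (real \<Rightarrow> real) \<Rightarrow> (real ^ 'd) set \<Rightarrow> nat \<Rightarrow> nat \<Rightarrow> real \<Rightarrow> real \<Rightarrow>
   (real ^ 'd \<Rightarrow> real) \<Rightarrow> (real \<Rightarrow> real ^ 'd \<Rightarrow> real) \<Rightarrow> bool" where
  "galerkin_solution \<epsilon> f \<Omega> M N s t u h \<longleftrightarrow>
     h \<in> trial_space \<Omega> M N s u \<and>
     (\<forall>v \<in> trial_space \<Omega> M N s u.
        (LINT r:{s..t}|lborel.
             L2_inner \<Omega> (time_deriv h r) (time_deriv v r)
           + \<epsilon> * L2_inner \<Omega> (grad (h r)) (grad (time_deriv v r))
           + 1 / \<epsilon> * L2_inner \<Omega> (\<lambda>x. f (h r x)) (time_deriv v r)) = 0)"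

end

theory Submission
  imports Defs "HOL-Library.Function_Algebras"
begin

text \<open>
  Every trial function is \<open>u + w\<close>, where the increment \<open>w\<close> belongs to the finite-dimensional linear
  space \<open>V\<close> of space-time polynomials that vanish on the boundary and at the initial time. A test
  function \<open>v\<close> occurs only through \<open>v\<^sub>t\<close>, so \<open>V\<close> is given the inner product \<open>ip v w = \<integral>\<integral> v\<^sub>t * w\<^sub>t\<close> over the
  cylinder, whose norm is \<open>nrm\<close>. The Galerkin problem asks for a zero of the nonlinear map
  \<open>w \<mapsto> residual (u + w)\<close> from \<open>V\<close> into its dual, and the point is that this map is strongly monotone.

  Let \<open>d\<close> be the difference of two trial functions. Testing the difference of their residuals with \<open>d\<close>
  gives three terms. The first is \<open>(nrm d)\<^sup>2\<close>. The second is
  \<open>\<epsilon> * \<integral>\<integral> \<nabla>d \<bullet> \<nabla>d\<^sub>t\<close>, which is half of \<open>\<epsilon>\<close> times the squared norm of the final gradient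
  and so nonnegative (\<open>J_grad_nonneg\<close>). With \<open>K = sup \<bar>f'\<bar> < L\<close>, the third is at least
  \<open>- (K / \<epsilon>) * \<integral>\<integral> \<bar>d * d\<^sub>t\<bar>\<close>. As \<open>d\<close> vanishes at the initial time, a Poincare inequality in time
  bounds the norm of \<open>d\<close> by \<open>\<tau>\<close> times the norm of \<open>d\<^sub>t\<close> (\<open>J_time_Poincare\<close>), so the third term is at
  least \<open>- (K * \<tau> / \<epsilon>) * (nrm d)\<^sup>2\<close>. Since \<open>K * \<tau> < L * \<tau> \<le> \<epsilon>\<close>, the monotonicity constant
  \<open>1 - K * \<tau> / \<epsilon>\<close> is positive (\<open>residual_strongly_monotone\<close>).

  Uniqueness follows at once. Existence is the finite-dimensional Browder--Minty theorem
  (\<open>monotone_galerkin_solvable\<close>), proved by adding one dimension at a time and solving one strictly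
  increasing scalar equation for each.

  For the energy law, the solution \<open>h\<close> is tested with itself: the terms with \<open>\<nabla>h \<bullet> \<nabla>h\<^sub>t\<close> and
  \<open>f h * h\<^sub>t\<close> add up to the time derivative of the energy density, so the equation reads
  \<open>\<integral>\<integral> h\<^sub>t\<^sup>2 + (energy at T - energy at s) = 0\<close>, where \<open>s\<close> and \<open>T\<close> are the ends of the time step.
\<close>

section \<open>Functions as a real vector space\<close>

instantiation "fun" :: (type, real_vector) real_vector
begin

definition scaleR_fun_def: "c *\<^sub>R f = (\<lambda>x. c *\<^sub>R f x)"

instance
  by standard (auto simp: scaleR_fun_def fun_eq_iff scaleR_add_right scaleR_add_left)

end

lemma scaleR_fun_apply [simp]: "(c *\<^sub>R f) x = c *\<^sub>R f x"
  by (simp add: scaleR_fun_def)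

section \<open>Strongly monotone equations on finite-dimensional spaces\<close>

text \<open>
  Strong monotonicity makes \<open>g\<close> grow at least like \<open>k * y\<close>, so \<open>g\<close> changes sign between the points
  \<open>\<plusminus> \<bar>g 0\<bar> / k\<close> and the intermediate value theorem applies.
\<close>
lemma strongly_increasing_has_zero:
  fixes g :: "real \<Rightarrow> real"
  assumes cont: "continuous_on UNIV g" and k: "k > 0"
    and mono: "\<And>y z. k * (y - z)\<^sup>2 \<le> (y - z) * (g y - g z)"
  shows "\<exists>y. g y = 0"
proof -
  define M where "M = \<bar>g 0\<bar> / k"
  have M0: "M \<ge> 0" and kM: "k * M = \<bar>g 0\<bar>" using k by (auto simp: M_def)
  have up: "g M \<ge> 0"
  proof (cases "M = 0")
    case False
    then have "M > 0" using M0 by simp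
    have "M * (k * M) \<le> M * (g M - g 0)" using mono[of M 0] by (simp add: power2_eq_square algebra_simps)
    then have "k * M \<le> g M - g 0" using \<open>M > 0\<close> by (simp add: mult_le_cancel_left_pos)
    then show ?thesis using kM by linarith
  qed (use kM in auto)
  have lo: "g (-M) \<le> 0"
  proof (cases "M = 0")
    case False
    then have "M > 0" using M0 by simp
    have "M * (k * M) \<le> M * (g 0 - g (-M))" using mono[of "-M" 0] by (simp add: power2_eq_square algebra_simps)
    then have "k * M \<le> g 0 - g (-M)" using \<open>M > 0\<close> by (simp add: mult_le_cancel_left_pos)
    then show ?thesis using kM by linarith
  qed (use kM in auto)
  have "\<exists>y\<ge>-M. y \<le> M \<and> g y = 0"
    by (rule IVT') (use lo up M0 cont in \<open>auto intro: continuous_on_subset\<close>)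
  then show ?thesis by blast
qed

text \<open>
  An inner product that is only required to behave on a subspace: the form used below is definite on
  polynomials, but not on arbitrary functions.
\<close>
locale inner_product_on =
  fixes V :: "'v::real_vector set" and ip :: "'v \<Rightarrow> 'v \<Rightarrow> real"
  assumes sub: "subspace V"
    and ip_add: "\<And>a b c. a \<in> V \<Longrightarrow> b \<in> V \<Longrightarrow> c \<in> V \<Longrightarrow> ip (a + b) c = ip a c + ip b c"
    and ip_scale: "\<And>r a c. a \<in> V \<Longrightarrow> c \<in> V \<Longrightarrow> ip (r *\<^sub>R a) c = r * ip a c"
    and ip_sym: "\<And>a b. a \<in> V \<Longrightarrow> b \<in> V \<Longrightarrow> ip a b = ip b a"
    and ip_nonneg: "\<And>a. a \<in> V \<Longrightarrow> ip a a \<ge> 0"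
    and ip_definite: "\<And>a. a \<in> V \<Longrightarrow> ip a a = 0 \<Longrightarrow> a = 0"
begin

definition nrm :: "'v \<Rightarrow> real" where "nrm a = sqrt (ip a a)"

lemma nrm_sq: "a \<in> V \<Longrightarrow> (nrm a)\<^sup>2 = ip a a"
  by (simp add: nrm_def ip_nonneg)

lemma nrm_nonneg: "a \<in> V \<Longrightarrow> nrm a \<ge> 0"
  by (simp add: nrm_def ip_nonneg)

lemma nrm_pos: "a \<in> V \<Longrightarrow> a \<noteq> 0 \<Longrightarrow> nrm a > 0"
  using ip_nonneg[of a] ip_definite[of a] by (force simp: nrm_def)

lemmas V_closed [simp, intro] =
  subspace_add[OF sub] subspace_diff[OF sub] subspace_scale[OF sub] subspace_0[OF sub]

lemma ip_diff: "a \<in> V \<Longrightarrow> b \<in> V \<Longrightarrow> c \<in> V \<Longrightarrow> ip (a - b) c = ip a c - ip b c"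
  using ip_add[of "a - b" b c] by simp

lemma ip_add_right: "a \<in> V \<Longrightarrow> b \<in> V \<Longrightarrow> c \<in> V \<Longrightarrow> ip c (a + b) = ip c a + ip c b"
  by (metis ip_add ip_sym V_closed(1))

lemma ip_scale_right: "a \<in> V \<Longrightarrow> c \<in> V \<Longrightarrow> ip c (r *\<^sub>R a) = r * ip c a"
  by (metis ip_scale ip_sym V_closed(3))

lemma ip_expand:
  assumes "a \<in> V" "b \<in> V"
  shows "ip (a + r *\<^sub>R b) (a + r *\<^sub>R b) = ip a a + 2 * r * ip a b + r\<^sup>2 * ip b b"
  using assms ip_sym[OF assms]
  by (simp add: ip_add ip_add_right ip_scale ip_scale_right power2_eq_square algebra_simps)

lemma Cauchy_Schwarz_nrm:
  assumes "a \<in> V" "b \<in> V" shows "\<bar>ip a b\<bar> \<le> nrm a * nrm b"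
proof (cases "b = 0")
  case True
  then have "ip a b = 0" using ip_scale_right[of b a 0] assms by simp
  then show ?thesis using nrm_nonneg assms by simp
next
  case False
  then have pos: "ip b b > 0" using assms ip_definite[of b] ip_nonneg[of b] by fastforce
  define r where "r = ip a b / ip b b"
  have "0 \<le> ip (a + (-r) *\<^sub>R b) (a + (-r) *\<^sub>R b)"
    using assms by (intro ip_nonneg V_closed)
  also have "\<dots> = ip a a - 2 * r * ip a b + r\<^sup>2 * ip b b"
    unfolding ip_expand[OF assms] by simp
  also have "\<dots> = ip a a - (ip a b)\<^sup>2 / ip b b"
    using pos by (simp add: r_def power2_eq_square)
  finally have "(ip a b)\<^sup>2 \<le> ip a a * ip b b" using pos by (simp add: field_simps)
  then have "\<bar>ip a b\<bar> \<le> sqrt (ip a a * ip b b)"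
    using real_sqrt_le_mono by fastforce
  then show ?thesis by (simp add: nrm_def real_sqrt_mult)
qed

text \<open>
  The finite-dimensional Browder--Minty theorem for strongly monotone maps, proved without coordinates
  and without a fixed point theorem: dimensions are added one at a time. When a new direction \<open>e\<close>, orthogonal to the old
  span, is added, the induction hypothesis solves the old equations for every prescribed coefficient
  \<open>y\<close> of \<open>e\<close>; let \<open>H y\<close> be the resulting vector. What remains is the single scalar equation
  \<open>R (H y) e = 0\<close>. Since \<open>R (H y)\<close> annihilates the old span,
  \<open>(y - z) * (R (H y) e - R (H z) e)\<close> is the full monotonicity expression for \<open>H y - H z\<close>, so the
  scalar equation inherits strong monotonicity, and also a Lipschitz bound on \<open>H\<close>.

  The Lipschitz constant of \<open>R\<close> may depend on the test vector. This is what makes the result usable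
  for forms whose boundedness is itself a finite-dimensional effect, such as the gradient term.
\<close>
lemma monotone_galerkin_solvable:
  fixes R :: "'v \<Rightarrow> 'v \<Rightarrow> real"
  assumes "finite B" "B \<subseteq> V" "\<mu> > 0"
    and "\<And>w a b. w \<in> V \<Longrightarrow> a \<in> V \<Longrightarrow> b \<in> V \<Longrightarrow> R w (a + b) = R w a + R w b"
    and "\<And>w a r. w \<in> V \<Longrightarrow> a \<in> V \<Longrightarrow> R w (r *\<^sub>R a) = r * R w a"
    and "\<And>a. a \<in> V \<Longrightarrow> \<exists>\<Lambda>. \<forall>w\<in>V. \<forall>w'\<in>V. \<bar>R w a - R w' a\<bar> \<le> \<Lambda> * nrm (w - w')"
    and "\<And>w w'. w \<in> V \<Longrightarrow> w' \<in> V \<Longrightarrow> \<mu> * (nrm (w - w'))\<^sup>2 \<le> R w (w - w') - R w' (w - w')"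
  shows "\<exists>w\<in>span B. \<forall>a\<in>span B. R w a = 0"
  using assms
proof (induction B arbitrary: R \<mu> rule: finite_induct)
  case empty
  have "R 0 0 = 0" using empty(4)[of 0 0 0] by simp
  then show ?case by simp
next
  case (insert b B)
  note R_add = insert.prems(3) and R_scale = insert.prems(4) and R_Lip = insert.prems(5)
    and R_mono = insert.prems(6)
  have b: "b \<in> V" and BV: "B \<subseteq> V" using insert.prems by auto
  have SV: "a \<in> V" if "a \<in> span B" for a
    using that BV sub span_minimal by blast
  \<comment> \<open>The orthogonal projection of \<open>b\<close> is itself the solution of a strongly monotone problem on \<open>span B\<close>.\<close>
  have "\<exists>p\<in>span B. \<forall>a\<in>span B. ip (p - b) a = 0"
  proof (rule insert.IH[where \<mu> = 1])
    fix a assume a: "a \<in> V"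
    show "\<exists>\<Lambda>. \<forall>w\<in>V. \<forall>w'\<in>V. \<bar>ip (w - b) a - ip (w' - b) a\<bar> \<le> \<Lambda> * nrm (w - w')"
    proof (intro exI ballI)
      fix w w' assume w: "w \<in> V" "w' \<in> V"
      have "ip (w - b) a - ip (w' - b) a = ip (w - w') a" using w a b by (simp add: ip_diff)
      then show "\<bar>ip (w - b) a - ip (w' - b) a\<bar> \<le> nrm a * nrm (w - w')"
        using Cauchy_Schwarz_nrm[of "w - w'" a] w a by (simp add: mult.commute)
    qed
  qed (use BV b in \<open>auto simp: ip_diff ip_add_right ip_scale_right nrm_sq algebra_simps\<close>)
  then obtain p where p: "p \<in> span B" and p_orth: "\<And>a. a \<in> span B \<Longrightarrow> ip (p - b) a = 0"
    by blast
  define e where "e = b - p"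
  have eV: "e \<in> V" using b p SV by (auto simp: e_def)
  have orth: "ip a e = 0" if "a \<in> span B" for a
    using p_orth[OF that] that SV b p ip_sym[of a e] eV by (simp add: e_def ip_diff)
  show ?case
  proof (cases "e = 0")
    case True
    then have "span (insert b B) = span B" using p by (simp add: e_def span_redundant)
    moreover have "\<exists>w\<in>span B. \<forall>a\<in>span B. R w a = 0"
      by (rule insert.IH[OF BV insert.prems(2)]) (use insert.prems in auto)
    ultimately show ?thesis by simp
  next
    case False
    have ne: "nrm e > 0" using nrm_pos[OF eV False] .
    have "\<exists>w\<in>span B. \<forall>a\<in>span B. R (w + y *\<^sub>R e) a = 0" for y
    proof (rule insert.IH[OF BV insert.prems(2)])
      fix a assume "a \<in> V"
      then obtain \<Lambda> where "\<forall>w\<in>V. \<forall>w'\<in>V. \<bar>R w a - R w' a\<bar> \<le> \<Lambda> * nrm (w - w')"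
        using R_Lip by blast
      then have "\<bar>R (w + y *\<^sub>R e) a - R (w' + y *\<^sub>R e) a\<bar>
          \<le> \<Lambda> * nrm ((w + y *\<^sub>R e) - (w' + y *\<^sub>R e))" if "w \<in> V" "w' \<in> V" for w w'
        using that eV by blast
      then show "\<exists>\<Lambda>. \<forall>w\<in>V. \<forall>w'\<in>V. \<bar>R (w + y *\<^sub>R e) a - R (w' + y *\<^sub>R e) a\<bar> \<le> \<Lambda> * nrm (w - w')"
        by auto
    next
      fix w w' assume "w \<in> V" "w' \<in> V"
      then show "\<mu> * (nrm (w - w'))\<^sup>2 \<le> R (w + y *\<^sub>R e) (w - w') - R (w' + y *\<^sub>R e) (w - w')"
        using R_mono[of "w + y *\<^sub>R e" "w' + y *\<^sub>R e"] eV by auto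
    qed (use eV R_add R_scale in auto)
    then obtain w where wS: "\<And>y. w y \<in> span B"
      and w0: "\<And>y a. a \<in> span B \<Longrightarrow> R (w y + y *\<^sub>R e) a = 0"
      by metis
    define H where "H y = w y + y *\<^sub>R e" for y
    define g where "g y = R (H y) e" for y
    have HV: "H y \<in> V" for y using SV wS eV by (auto simp: H_def)
    have H_diff: "H y - H z = (w y - w z) + (y - z) *\<^sub>R e" for y z
      by (simp add: H_def algebra_simps)
    have RH: "R (H x) (H y - H z) = (y - z) * g x" for x y z
    proof -
      have "w y - w z \<in> span B" using wS by (simp add: span_diff)
      then have "R (H x) (w y - w z) = 0" using w0 by (simp add: H_def)
      then show ?thesis
        using HV eV SV wS unfolding H_diff g_def by (simp add: R_add R_scale)
    qed
    \<comment> \<open>The scalar equation inherits monotonicity, because the old components of the residual vanish.\<close>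
    have mono: "\<mu> * (nrm (H y - H z))\<^sup>2 \<le> (y - z) * (g y - g z)" for y z
      using R_mono[OF HV HV, of y z] by (simp add: RH algebra_simps)
    \<comment> \<open>Orthogonality of \<open>e\<close> turns growth in \<open>H y - H z\<close> into growth in \<open>y - z\<close>.\<close>
    have lower: "(nrm e)\<^sup>2 * (y - z)\<^sup>2 \<le> (nrm (H y - H z))\<^sup>2" for y z
    proof -
      let ?d = "w y - w z" and ?r = "y - z"
      have d: "?d \<in> span B" "?d \<in> V" using wS SV by (auto simp: span_diff)
      have "(nrm (H y - H z))\<^sup>2 = ip (?d + ?r *\<^sub>R e) (?d + ?r *\<^sub>R e)"
        using nrm_sq[OF V_closed(2)[OF HV[of y] HV[of z]]] by (simp only: H_diff)
      also have "\<dots> = ip ?d ?d + 2 * ?r * ip ?d e + ?r\<^sup>2 * ip e e"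
        by (rule ip_expand[OF d(2) eV])
      also have "\<dots> = ip ?d ?d + (nrm e)\<^sup>2 * ?r\<^sup>2" using orth[OF d(1)] eV by (simp add: nrm_sq)
      finally show ?thesis using ip_nonneg[OF d(2)] by simp
    qed
    obtain \<Lambda> where \<Lambda>: "\<And>w w'. w \<in> V \<Longrightarrow> w' \<in> V \<Longrightarrow> \<bar>R w e - R w' e\<bar> \<le> \<Lambda> * nrm (w - w')"
      using R_Lip[OF eV] by blast
    have g_le: "\<bar>g y - g z\<bar> \<le> \<bar>\<Lambda>\<bar> * nrm (H y - H z)" for y z
      using \<Lambda>[OF HV HV, of y z] nrm_nonneg[of "H y - H z"] HV
      by (smt (verit) g_def mult_right_mono V_closed(2))
    have H_Lip: "\<mu> * nrm (H y - H z) \<le> \<bar>\<Lambda>\<bar> * \<bar>y - z\<bar>" for y z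
    proof (cases "nrm (H y - H z) = 0")
      case False
      then have pos: "nrm (H y - H z) > 0" using nrm_nonneg[of "H y - H z"] HV by force
      have "\<mu> * nrm (H y - H z) * nrm (H y - H z) \<le> (y - z) * (g y - g z)"
        using mono[of y z] by (simp add: power2_eq_square algebra_simps)
      also have "\<dots> \<le> \<bar>y - z\<bar> * (\<bar>\<Lambda>\<bar> * nrm (H y - H z))"
        by (rule order_trans[OF abs_ge_self]) (simp add: abs_mult mult_left_mono g_le)
      finally show ?thesis using pos by (simp add: algebra_simps)
    qed auto
    have "\<bar>g y - g z\<bar> \<le> \<bar>\<Lambda>\<bar> * \<bar>\<Lambda>\<bar> / \<mu> * \<bar>y - z\<bar>" for y z
    proof -
      have "nrm (H y - H z) \<le> \<bar>\<Lambda>\<bar> * \<bar>y - z\<bar> / \<mu>"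
        using H_Lip[of y z] insert.prems(2) by (simp add: field_simps)
      then have "\<bar>\<Lambda>\<bar> * nrm (H y - H z) \<le> \<bar>\<Lambda>\<bar> * (\<bar>\<Lambda>\<bar> * \<bar>y - z\<bar> / \<mu>)"
        by (rule mult_left_mono) simp
      then show ?thesis using g_le[of y z] by simp
    qed
    then have "(\<bar>\<Lambda>\<bar> * \<bar>\<Lambda>\<bar> / \<mu>)-lipschitz_on UNIV g"
      using insert.prems(2) by (intro lipschitz_onI) (auto simp: dist_real_def)
    then have "continuous_on UNIV g" by (rule lipschitz_on_continuous_on)
    moreover have "\<mu> * (nrm e)\<^sup>2 > 0" using ne insert.prems(2) by simp
    moreover have "\<mu> * (nrm e)\<^sup>2 * (y - z)\<^sup>2 \<le> (y - z) * (g y - g z)" for y z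
      using order_trans[OF mult_left_mono[OF lower[of y z], of \<mu>] mono[of y z]] insert.prems(2)
      by (simp add: mult.assoc)
    ultimately obtain y where y: "g y = 0" using strongly_increasing_has_zero by blast
    show ?thesis
    proof (intro bexI[of _ "H y"] ballI)
      have eS: "e \<in> span (insert b B)"
        unfolding e_def using p by (intro span_diff) (auto simp: span_base span_mono[THEN subsetD, OF subset_insertI])
      then show "H y \<in> span (insert b B)"
        unfolding H_def using wS by (intro span_add span_scale) (auto intro: span_mono[THEN subsetD, OF subset_insertI])
      fix a assume "a \<in> span (insert b B)"
      then obtain k where k: "a - k *\<^sub>R b \<in> span B" by (auto simp: span_breakdown_eq)
      define a0 where "a0 = a - k *\<^sub>R b + k *\<^sub>R p"
      have a0: "a0 \<in> span B" unfolding a0_def using k p by (intro span_add span_scale)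
      have "a = a0 + k *\<^sub>R e" by (simp add: a0_def e_def algebra_simps)
      then have "R (H y) a = R (H y) a0 + k * g y"
        using HV SV[OF a0] eV by (simp add: R_add R_scale g_def)
      then show "R (H y) a = 0" using w0[OF a0] y by (simp add: H_def)
    qed
  qed
qed

text \<open>
  The Riesz vector of \<open>l\<close> solves the strongly monotone problem \<open>ip w a - l a = 0\<close>, and the
  Cauchy--Schwarz inequality then bounds \<open>l\<close>. This replaces an inverse inequality for polynomials.
\<close>
lemma linear_functional_bounded:
  assumes "finite B" "span B = V"
    and "\<And>a b. a \<in> V \<Longrightarrow> b \<in> V \<Longrightarrow> l (a + b) = l a + l b"
    and "\<And>a r. a \<in> V \<Longrightarrow> l (r *\<^sub>R a) = r * l a"
  shows "\<exists>C. \<forall>a\<in>V. \<bar>l a\<bar> \<le> C * nrm a"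
proof -
  have BV: "B \<subseteq> V" using assms(2) span_superset by blast
  have "\<exists>w\<in>span B. \<forall>a\<in>span B. ip w a - l a = 0"
  proof (rule monotone_galerkin_solvable[where \<mu> = 1])
    fix a assume a: "a \<in> V"
    have "\<bar>ip w a - l a - (ip w' a - l a)\<bar> \<le> nrm a * nrm (w - w')" if "w \<in> V" "w' \<in> V" for w w'
      using Cauchy_Schwarz_nrm[of "w - w'" a] that a by (simp add: ip_diff mult.commute)
    then show "\<exists>\<Lambda>. \<forall>w\<in>V. \<forall>w'\<in>V. \<bar>ip w a - l a - (ip w' a - l a)\<bar> \<le> \<Lambda> * nrm (w - w')"
      by blast
  qed (use assms BV in \<open>auto simp: ip_diff ip_add_right ip_scale_right nrm_sq algebra_simps\<close>)
  then obtain w where "w \<in> V" "\<And>a. a \<in> V \<Longrightarrow> l a = ip w a"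
    using assms(2) by auto
  then show ?thesis using Cauchy_Schwarz_nrm by (intro exI[of _ "nrm w"]) auto
qed

end

section \<open>Integrals over space-time cylinders\<close>

lemma set_integrable_continuous_on_bounded:
  fixes g :: "'a::euclidean_space \<Rightarrow> 'b::euclidean_space"
  assumes "bounded A" "A \<in> sets borel" "continuous_on UNIV g"
  shows "set_integrable lborel A g"
proof -
  have "set_integrable lborel (closure A) g"
    unfolding set_integrable_def
    by (rule borel_integrable_compact)
       (use assms in \<open>auto simp: compact_closure intro: continuous_on_subset\<close>)
  then show ?thesis
    by (rule set_integrable_subset) (use assms closure_subset in auto)
qed

text \<open>
  The set where \<open>g \<noteq> 0\<close> inside \<open>U\<close> is open, and it is a null set; nonempty open sets are not null.
\<close>
lemma continuous_eq_0_of_integral_0: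
  fixes g :: "'a::euclidean_space \<Rightarrow> real"
  assumes cont: "continuous_on UNIV g" and nonneg: "\<And>x. 0 \<le> g x"
    and A: "bounded A" "A \<in> sets borel" and U: "open U" "U \<subseteq> A"
    and zero: "(LINT x:A|lborel. g x) = 0" and x: "x \<in> U"
  shows "g x = 0"
proof (rule ccontr)
  assume nz: "g x \<noteq> 0"
  define O' where "O' = U \<inter> {y. g y \<noteq> 0}"
  have "open {y. g y \<noteq> 0}"
    using cont by (simp add: open_Collect_neq)
  then have "open O'" "O' \<noteq> {}" using U x nz by (auto simp: O'_def)
  have "AE y in lborel. indicator A y *\<^sub>R g y = 0"
    using zero set_integrable_continuous_on_bounded[OF A cont] nonneg
    unfolding set_lebesgue_integral_def set_integrable_def
    by (subst (asm) integral_nonneg_eq_0_iff_AE) auto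
  then have "AE y in lborel. y \<notin> O'"
    by (rule AE_mp) (use U in \<open>auto simp: O'_def indicator_def\<close>)
  then have "O' \<in> null_sets lborel"
    using \<open>open O'\<close> by (subst (asm) AE_iff_null_sets[symmetric]) auto
  then have "negligible O'"
    by (simp add: negligible_iff_null_sets null_sets_completionI)
  then show False using open_not_negligible \<open>open O'\<close> \<open>O' \<noteq> {}\<close> by blast
qed

text \<open>
  Integration against the measure of the product space, rather than an iterated integral, so that
  linearity and monotonicity come for free and both orders of integration are on an equal footing.
\<close>
definition cylinder_integral :: "real \<Rightarrow> real \<Rightarrow> 'a::euclidean_space set \<Rightarrow> (real \<Rightarrow> 'a \<Rightarrow> real) \<Rightarrow> real"
  where "cylinder_integral s T \<Omega> g = (LINT z:{s..T} \<times> \<Omega>|lborel. g (fst z) (snd z))"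

abbreviation jointly_continuous :: "(real \<Rightarrow> 'a::euclidean_space \<Rightarrow> 'b::euclidean_space) \<Rightarrow> bool"
  where "jointly_continuous g \<equiv> continuous_on UNIV (\<lambda>z. g (fst z) (snd z))"

locale cylinder =
  fixes s T :: real and \<Omega> :: "'a::euclidean_space set"
  assumes time: "s < T" and bounded: "bounded \<Omega>" and open_dom: "open \<Omega>"
begin

abbreviation J where "J \<equiv> cylinder_integral s T \<Omega>"

lemma cylinder_bounded: "bounded ({s..T} \<times> \<Omega>)" "{s..T} \<times> \<Omega> \<in> sets borel"
  using bounded open_dom by (auto intro: bounded_Times borel_Times)

lemma cylinder_integrable:
  "jointly_continuous g \<Longrightarrow> set_integrable lborel ({s..T} \<times> \<Omega>) (\<lambda>z. g (fst z) (snd z))"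
  for g :: "real \<Rightarrow> 'a \<Rightarrow> real"
  by (intro set_integrable_continuous_on_bounded cylinder_bounded)

lemma J_add:
  "jointly_continuous g \<Longrightarrow> jointly_continuous k \<Longrightarrow> J (\<lambda>t x. g t x + k t x) = J g + J k"
  unfolding cylinder_integral_def by (intro set_integral_add cylinder_integrable)

lemma J_diff:
  "jointly_continuous g \<Longrightarrow> jointly_continuous k \<Longrightarrow> J (\<lambda>t x. g t x - k t x) = J g - J k"
  unfolding cylinder_integral_def by (intro set_integral_diff cylinder_integrable)

lemma J_cmult: "J (\<lambda>t x. c * g t x) = c * J g"
  unfolding cylinder_integral_def by (rule set_integral_mult_right)

lemma J_mono:
  assumes "jointly_continuous g" "jointly_continuous k"
    "\<And>t x. t \<in> {s..T} \<Longrightarrow> x \<in> \<Omega> \<Longrightarrow> g t x \<le> k t x"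
  shows "J g \<le> J k"
  unfolding cylinder_integral_def
  by (intro set_integral_mono cylinder_integrable) (use assms in auto)

lemma J_nonneg: "(\<And>t x. 0 \<le> g t x) \<Longrightarrow> 0 \<le> J g"
  unfolding cylinder_integral_def set_lebesgue_integral_def
  by (intro Bochner_Integration.integral_nonneg) simp

lemma J_eq_0D:
  assumes "jointly_continuous g" "\<And>t x. 0 \<le> g t x" "J g = 0" "s < t" "t < T" "x \<in> \<Omega>"
  shows "g t x = 0"
proof -
  have "open ({s<..<T} \<times> \<Omega>)" "{s<..<T} \<times> \<Omega> \<subseteq> {s..T} \<times> \<Omega>"
    using open_dom by (auto intro: open_Times)
  then show ?thesis
    using continuous_eq_0_of_integral_0[of "\<lambda>z. g (fst z) (snd z)" "{s..T} \<times> \<Omega>" "{s<..<T} \<times> \<Omega>" "(t,x)"]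
      assms cylinder_bounded by (auto simp: cylinder_integral_def)
qed

lemma cylinder_integrand_product:
  "(\<lambda>z. indicator ({s..T} \<times> \<Omega>) z *\<^sub>R g (fst z) (snd z)) =
    (\<lambda>(t, x). indicator {s..T} t *\<^sub>R indicator \<Omega> x *\<^sub>R (g t x :: real))"
  by (auto simp: indicator_def fun_eq_iff)

lemma product_integrable:
  assumes "jointly_continuous g"
  shows "integrable (lborel \<Otimes>\<^sub>M lborel) (\<lambda>(t, x). indicator {s..T} t *\<^sub>R indicator \<Omega> x *\<^sub>R (g t x :: real))"
  using cylinder_integrable[OF assms]
  unfolding set_integrable_def lborel_prod cylinder_integrand_product .

lemma J_time_space:
  assumes "jointly_continuous g"
  shows "J g = (LINT t:{s..T}|lborel. LINT x:\<Omega>|lborel. g t x)"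
  using lborel_pair.integral_fst[OF product_integrable[OF assms]]
  unfolding cylinder_integral_def set_lebesgue_integral_def lborel_prod cylinder_integrand_product
  by simp

lemma J_space_time:
  assumes "jointly_continuous g"
  shows "J g = (LINT x:\<Omega>|lborel. LINT t:{s..T}|lborel. g t x)"
  using lborel_pair.integral_snd[OF product_integrable[OF assms]]
  unfolding cylinder_integral_def set_lebesgue_integral_def lborel_prod cylinder_integrand_product
  by (simp add: mult.left_commute)

lemma space_integrable_time_integral:
  fixes g :: "real \<Rightarrow> 'a \<Rightarrow> real"
  assumes "jointly_continuous g"
  shows "set_integrable lborel \<Omega> (\<lambda>x. LINT t:{s..T}|lborel. g t x)"
  using lborel_pair.integrable_snd[OF product_integrable[OF assms]]
  unfolding set_integrable_def set_lebesgue_integral_def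
  by (simp add: mult.left_commute)

lemma J_Cauchy_Schwarz:
  assumes g: "jointly_continuous g" and k: "jointly_continuous k"
  shows "J (\<lambda>t x. \<bar>g t x * k t x\<bar>) \<le> sqrt (J (\<lambda>t x. (g t x)\<^sup>2)) * sqrt (J (\<lambda>t x. (k t x)\<^sup>2))"
proof -
  define a b X where "a = J (\<lambda>t x. (g t x)\<^sup>2)" and "b = J (\<lambda>t x. (k t x)\<^sup>2)"
    and "X = J (\<lambda>t x. \<bar>g t x * k t x\<bar>)"
  have ab: "a \<ge> 0" "b \<ge> 0" "X \<ge> 0" unfolding a_def b_def X_def by (auto intro!: J_nonneg)
  \<comment> \<open>The usual discriminant argument: the integral of \<open>(r * \<bar>g\<bar> - \<bar>k\<bar>)\<^sup>2\<close> is nonnegative for every \<open>r\<close>.\<close>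
  have quad: "2 * r * X \<le> r\<^sup>2 * a + b" for r
  proof -
    have "2 * r * X = J (\<lambda>t x. (2 * r) * \<bar>g t x * k t x\<bar>)" unfolding X_def J_cmult ..
    also have "\<dots> \<le> J (\<lambda>t x. r\<^sup>2 * (g t x)\<^sup>2 + (k t x)\<^sup>2)"
    proof (rule J_mono)
      fix t x
      have "0 \<le> (r * \<bar>g t x\<bar> - \<bar>k t x\<bar>)\<^sup>2" by simp
      then show "(2 * r) * \<bar>g t x * k t x\<bar> \<le> r\<^sup>2 * (g t x)\<^sup>2 + (k t x)\<^sup>2"
        by (simp add: power2_diff power_mult_distrib abs_mult algebra_simps)
    qed (intro continuous_intros g k)+
    also have "\<dots> = r\<^sup>2 * a + b"
      unfolding a_def b_def J_cmult[symmetric]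
      by (rule J_add) (intro continuous_intros g k)+
    finally show ?thesis .
  qed
  have "X\<^sup>2 \<le> a * b"
  proof (cases "a = 0")
    case True
    have "X = 0"
    proof (rule ccontr)
      assume "X \<noteq> 0"
      \<comment> \<open>With \<open>a = 0\<close> the right-hand side of \<open>quad\<close> is constant in \<open>r\<close>; this \<open>r\<close> makes the left-hand side exceed it.\<close>
      then show False using quad[of "(b + 1) / X"] True ab by simp
    qed
    then show ?thesis using ab by simp
  next
    case False
    then show ?thesis using quad[of "X / a"] ab
      by (simp add: power2_eq_square field_simps)
  qed
  then have "X \<le> sqrt (a * b)" by (rule real_le_rsqrt)
  then show ?thesis by (simp add: a_def b_def X_def real_sqrt_mult)
qed

end

lemma set_integrable_Icc:
  fixes g :: "real \<Rightarrow> real"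
  shows "continuous_on UNIV g \<Longrightarrow> set_integrable lborel {a..b} g"
  by (intro set_integrable_continuous_on_bounded) auto

lemma FTC_set_integral:
  fixes P g :: "real \<Rightarrow> real"
  assumes "a \<le> b" "\<And>r. (P has_real_derivative g r) (at r)" "continuous_on UNIV g"
  shows "(LINT r:{a..b}|lborel. g r) = P b - P a"
  unfolding set_lebesgue_integral_def using assms
  by (intro integral_FTC_atLeastAtMost)
    (auto simp flip: has_real_derivative_iff_has_vector_derivative
      intro: continuous_on_subset has_field_derivative_at_within)

lemma primitive_square_le:
  fixes W w :: "real \<Rightarrow> real"
  assumes "s \<le> r" and D: "\<And>r. (W has_real_derivative w r) (at r)" and cont: "continuous_on UNIV w"
    and W0: "W s = 0"
  shows "(W r)\<^sup>2 \<le> (r - s) * (LINT q:{s..r}|lborel. (w q)\<^sup>2)"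
proof (cases "r = s")
  case False
  then have rs: "r - s > 0" using assms by simp
  define m where "m = W r / (r - s)"
  have W: "(LINT q:{s..r}|lborel. w q) = W r" using FTC_set_integral[OF assms(1) D cont] W0 by simp
  \<comment> \<open>Since \<open>m\<close> is the mean of \<open>w\<close>, this is the Cauchy--Schwarz inequality against the constant function.\<close>
  have "0 \<le> (LINT q:{s..r}|lborel. (w q - m)\<^sup>2)"
    unfolding set_lebesgue_integral_def by (intro Bochner_Integration.integral_nonneg) simp
  also have "\<dots> = (LINT q:{s..r}|lborel. (w q)\<^sup>2 - (2 * m) * w q + m\<^sup>2)"
    by (simp add: power2_diff algebra_simps)
  also have "\<dots> = (LINT q:{s..r}|lborel. (w q)\<^sup>2) - (2 * m) * W r + (LINT q:{s..r}|lborel. m\<^sup>2)"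
    unfolding W[symmetric] set_integral_mult_right[symmetric]
    by (subst set_integral_add(2) set_integral_diff(2);
        (intro set_integrable_Icc continuous_intros cont)?)+ simp
  also have "(LINT q:{s..r}|lborel. m\<^sup>2) = m\<^sup>2 * (r - s)"
    using assms(1) by (simp add: set_lebesgue_integral_def)
  finally have "(W r)\<^sup>2 / (r - s) \<le> (LINT q:{s..r}|lborel. (w q)\<^sup>2)"
    using rs by (simp add: m_def power2_eq_square)
  then show ?thesis using rs by (simp add: field_simps)
qed (use W0 in simp)

text \<open>
  The factor \<open>(T - s)\<^sup>2\<close> is where the length of the time step enters the smallness condition. Integrating
  \<open>r - s\<close> instead of its upper bound \<open>T - s\<close> would give half of it.
\<close>
lemma time_Poincare:
  fixes W w :: "real \<Rightarrow> real"
  assumes "s \<le> T" and D: "\<And>r. (W has_real_derivative w r) (at r)" and cont: "continuous_on UNIV w"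
    and W0: "W s = 0"
  shows "(LINT r:{s..T}|lborel. (W r)\<^sup>2) \<le> (T - s)\<^sup>2 * (LINT r:{s..T}|lborel. (w r)\<^sup>2)"
proof -
  let ?K = "LINT r:{s..T}|lborel. (w r)\<^sup>2"
  have contW: "continuous_on UNIV W" using D DERIV_continuous_on by blast
  have le: "(W r)\<^sup>2 \<le> (T - s) * ?K" if "r \<in> {s..T}" for r
  proof -
    have mono: "(LINT q:{s..r}|lborel. (w q)\<^sup>2) \<le> ?K"
      unfolding set_lebesgue_integral_def
    proof (rule Bochner_Integration.integral_mono)
      show "integrable lborel (\<lambda>x. indicator {s..r} x *\<^sub>R (w x)\<^sup>2)"
        "integrable lborel (\<lambda>x. indicator {s..T} x *\<^sub>R (w x)\<^sup>2)"
        by (auto simp flip: set_integrable_def intro!: set_integrable_Icc continuous_intros cont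
            simp del: real_scaleR_def)
    qed (use that in \<open>auto simp: indicator_def\<close>)
    have "(W r)\<^sup>2 \<le> (r - s) * (LINT q:{s..r}|lborel. (w q)\<^sup>2)"
      using primitive_square_le[OF _ D cont W0] that by auto
    also have "\<dots> \<le> (T - s) * ?K"
      using that mono
      by (intro mult_mono) (auto simp: set_lebesgue_integral_def intro!: Bochner_Integration.integral_nonneg)
    finally show ?thesis .
  qed
  have "(LINT r:{s..T}|lborel. (W r)\<^sup>2) \<le> (LINT r:{s..T}|lborel. (T - s) * ?K)"
    by (intro set_integral_mono set_integrable_Icc continuous_intros contW le)
  also have "\<dots> = (T - s)\<^sup>2 * ?K"
    using assms(1) by (simp add: set_lebesgue_integral_def power2_eq_square)
  finally show ?thesis .
qed

lemma jointly_continuous_time_slice: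
  "jointly_continuous g \<Longrightarrow> continuous_on UNIV (\<lambda>t. g t x)"
  by (rule continuous_on_compose2[of UNIV "\<lambda>z. g (fst z) (snd z)" UNIV "\<lambda>t. (t, x)", simplified])
    (auto intro!: continuous_intros)

lemma jointly_continuous_space_slice:
  "jointly_continuous g \<Longrightarrow> continuous_on UNIV (g t)"
  by (rule continuous_on_compose2[of UNIV "\<lambda>z. g (fst z) (snd z)" UNIV "\<lambda>x. (t, x)", simplified])
    (auto intro!: continuous_intros)

context cylinder
begin

lemma J_abs: 
  assumes "jointly_continuous g" shows "\<bar>J g\<bar> \<le> J (\<lambda>t x. \<bar>g t x\<bar>)"
proof -
  have "J g \<le> J (\<lambda>t x. \<bar>g t x\<bar>)"
    by (rule J_mono) (auto intro!: continuous_intros assms)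
  moreover have "J (\<lambda>t x. (-1) * g t x) \<le> J (\<lambda>t x. \<bar>g t x\<bar>)"
    by (rule J_mono) (auto intro!: continuous_intros assms)
  ultimately show ?thesis unfolding J_cmult by simp
qed

text \<open>
  For each fixed point of \<open>\<Omega>\<close> the time integral is evaluated by the fundamental theorem of calculus;
  Fubini's theorem carries this to the cylinder. Both the energy identity and the nonnegativity of the
  gradient term come from here.
\<close>
lemma J_FTC:
  assumes "jointly_continuous g" "\<And>t x. ((\<lambda>r. P r x) has_real_derivative g t x) (at t)"
  shows "J g = (LINT x:\<Omega>|lborel. P T x - P s x)"
proof -
  have "(LINT t:{s..T}|lborel. g t x) = P T x - P s x" for x
    using time by (intro FTC_set_integral assms(2) jointly_continuous_time_slice[OF assms(1)]) simp
  then show ?thesis unfolding J_space_time[OF assms(1)] by simp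
qed

lemma J_time_Poincare:
  assumes W: "jointly_continuous W" and w: "jointly_continuous w"
    and D: "\<And>t x. ((\<lambda>r. W r x) has_real_derivative w t x) (at t)"
    and W0: "\<And>x. x \<in> \<Omega> \<Longrightarrow> W s x = 0"
  shows "J (\<lambda>t x. (W t x)\<^sup>2) \<le> (T - s)\<^sup>2 * J (\<lambda>t x. (w t x)\<^sup>2)"
proof -
  have c: "jointly_continuous (\<lambda>t x. (W t x)\<^sup>2)" "jointly_continuous (\<lambda>t x. (w t x)\<^sup>2)"
    by (intro continuous_intros W w)+
  have "J (\<lambda>t x. (W t x)\<^sup>2) = (LINT x:\<Omega>|lborel. LINT t:{s..T}|lborel. (W t x)\<^sup>2)"
    by (rule J_space_time[OF c(1)])
  also have "\<dots> \<le> (LINT x:\<Omega>|lborel. (T - s)\<^sup>2 * (LINT t:{s..T}|lborel. (w t x)\<^sup>2))"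
  proof (rule set_integral_mono)
    show "set_integrable lborel \<Omega> (\<lambda>x. LINT t:{s..T}|lborel. (W t x)\<^sup>2)"
      by (rule space_integrable_time_integral[OF c(1)])
    show "set_integrable lborel \<Omega> (\<lambda>x. (T - s)\<^sup>2 * (LINT t:{s..T}|lborel. (w t x)\<^sup>2))"
      using space_integrable_time_integral[OF c(2)] by (intro set_integrable_mult_right)
    fix x assume "x \<in> \<Omega>"
    then show "(LINT t:{s..T}|lborel. (W t x)\<^sup>2) \<le> (T - s)\<^sup>2 * (LINT t:{s..T}|lborel. (w t x)\<^sup>2)"
      using time W0 by (intro time_Poincare D jointly_continuous_time_slice w) auto
  qed
  also have "\<dots> = (T - s)\<^sup>2 * J (\<lambda>t x. (w t x)\<^sup>2)"
    unfolding J_space_time[OF c(2)] by (rule set_integral_mult_right)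
  finally show ?thesis .
qed

end

section \<open>Polynomials in space and time\<close>

lemma GDERIV_imp_continuous_on: "(\<And>x. GDERIV p x :> G x) \<Longrightarrow> continuous_on UNIV p"
  unfolding gderiv_def by (metis continuous_at_imp_continuous_on has_derivative_continuous)

text \<open>
  The functions with a continuous gradient contain the constants and the coordinates, and they are
  closed under sums and products.
\<close>
lemma gradient_continuously_exists:
  assumes "p \<in> poly_space M"
  shows "\<exists>G. (\<forall>x. GDERIV p x :> G x) \<and> continuous_on UNIV G"
proof -
  define C1 where "C1 = {p :: real^'a \<Rightarrow> real. \<exists>G. (\<forall>x. GDERIV p x :> G x) \<and> continuous_on UNIV G}"
  have const: "(\<lambda>x. c) \<in> C1" for c
    by (auto simp: C1_def intro!: exI[of _ "\<lambda>x. 0"] GDERIV_const)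
  have coord: "(\<lambda>x. x $ i) \<in> C1" for i
  proof -
    have "GDERIV (\<lambda>x::real^'a. x $ i) x :> axis i 1" for x
      unfolding gderiv_def inner_axis
      using bounded_linear_imp_has_derivative[OF bounded_linear_vec_nth[of i]] by simp
    then show ?thesis by (auto simp: C1_def intro!: exI[of _ "\<lambda>x. axis i 1"])
  qed
  have add: "(\<lambda>x. p x + q x) \<in> C1" if pq: "p \<in> C1" "q \<in> C1" for p q
  proof -
    from pq obtain G H where "\<forall>x. GDERIV p x :> G x" "continuous_on UNIV G"
      "\<forall>x. GDERIV q x :> H x" "continuous_on UNIV H" by (auto simp: C1_def)
    then show ?thesis
      by (auto simp: C1_def intro!: exI[of _ "\<lambda>x. G x + H x"] GDERIV_add continuous_intros)
  qed
  have mult: "(\<lambda>x. p x * q x) \<in> C1" if pq: "p \<in> C1" "q \<in> C1" for p q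
  proof -
    from pq obtain G H where *: "\<forall>x. GDERIV p x :> G x" "continuous_on UNIV G"
      "\<forall>x. GDERIV q x :> H x" "continuous_on UNIV H" by (auto simp: C1_def)
    have "continuous_on UNIV p" "continuous_on UNIV q"
      using * GDERIV_imp_continuous_on by blast+
    with * show ?thesis
      by (auto simp: C1_def intro!: exI[of _ "\<lambda>x. p x *\<^sub>R H x + q x *\<^sub>R G x"] GDERIV_mult continuous_intros)
  qed
  have power: "(\<lambda>x. (x $ i) ^ k) \<in> C1" for i and k :: nat
    by (induction k) (use const mult coord in \<open>auto simp: power_Suc\<close>)
  have prod: "(\<lambda>x. \<Prod>i\<in>I. p i x) \<in> C1" if "finite I" "\<And>i. p i \<in> C1" for I :: "'a set" and p
    using that by (induction I rule: finite_induct) (auto intro: const mult)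
  have sum: "(\<lambda>x. \<Sum>i\<in>I. p i x) \<in> C1" if "finite I" "\<And>i. p i \<in> C1" for I :: "('a \<Rightarrow> nat) set" and p
    using that by (induction I rule: finite_induct) (auto intro: const add)
  obtain c where p: "p = (\<lambda>x. \<Sum>\<alpha>\<in>multi_indices M. c \<alpha> * (\<Prod>i\<in>UNIV. (x $ i) ^ \<alpha> i))"
    using assms by (auto simp: poly_space_def)
  have "p \<in> C1" unfolding p
    by (intro sum mult prod power const finite_multi_indices finite)
  then show ?thesis by (simp add: C1_def)
qed

lemma GDERIV_poly_space:
  assumes "p \<in> poly_space M"
  shows "GDERIV p x :> grad p x"
  using gradient_continuously_exists[OF assms] grad_eqI by metis

lemma continuous_grad_poly_space:
  assumes "p \<in> poly_space M"
  shows "continuous_on UNIV (grad p)"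
proof -
  obtain G where G: "\<And>x. GDERIV p x :> G x" "continuous_on UNIV G"
    using gradient_continuously_exists[OF assms] by blast
  then have "grad p = G" by (auto intro: grad_eqI)
  then show ?thesis using G by simp
qed

lemma poly_space_continuous: "p \<in> poly_space M \<Longrightarrow> continuous_on UNIV p"
  using GDERIV_imp_continuous_on GDERIV_poly_space by blast

text \<open>
  On the line through a point of \<open>U\<close> and \<open>x\<close>, the polynomial becomes a univariate one, which has
  infinitely many zeros.
\<close>
lemma poly_space_eq_0_of_open:
  assumes p: "p \<in> poly_space M" and U: "open U" "U \<noteq> {}" and zero: "\<And>x. x \<in> U \<Longrightarrow> p x = 0"
  shows "p x = 0"
proof -
  obtain a where a: "a \<in> U" using U by blast
  then obtain e where e: "e > 0" "ball a e \<subseteq> U" using U openE by blast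
  define l where "l r = a + r *\<^sub>R (x - a)" for r :: real
  obtain c where pc: "p = (\<lambda>x. \<Sum>\<alpha>\<in>multi_indices M. c \<alpha> * (\<Prod>i\<in>UNIV. (x $ i) ^ \<alpha> i))"
    using p by (auto simp: poly_space_def)
  define q where "q = (\<Sum>\<alpha>\<in>multi_indices M. smult (c \<alpha>) (\<Prod>i\<in>UNIV. [:a $ i, x $ i - a $ i:] ^ \<alpha> i))"
  have q: "poly q r = p (l r)" for r
    by (simp add: q_def pc l_def poly_sum poly_prod poly_power)
  define d where "d = e / (norm (x - a) + 1)"
  have d: "d > 0" using e norm_ge_zero[of "x - a"] by (simp add: d_def add_nonneg_pos)
  have "poly q r = 0" if "r \<in> {0<..<d}" for r
  proof -
    have "r * norm (x - a) \<le> r * (norm (x - a) + 1)" using that by (simp add: mult_left_mono)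
    also have "\<dots> < e"
      using that norm_ge_zero[of "x - a"] by (simp add: d_def less_divide_eq add_nonneg_pos)
    finally have "dist a (l r) < e" using that by (simp add: l_def dist_norm)
    then show ?thesis using e zero by (auto simp: q)
  qed
  then have "{0<..<d} \<subseteq> {r. poly q r = 0}" by blast
  then have "infinite {r. poly q r = 0}" using d infinite_Ioo finite_subset by blast
  then have "q = 0" using poly_roots_finite by blast
  then have "poly q 1 = 0" by simp
  then show ?thesis by (simp add: q l_def)
qed

lemma fun_sum_apply: "(\<Sum>i\<in>I. g i) x = (\<Sum>i\<in>I. g i x)"
  by (induction I rule: infinite_finite_induct) auto

lemma subspace_poly_space: "subspace (poly_space M)"
proof (rule subspaceI)
  show "0 \<in> poly_space M" by (auto simp: poly_space_def intro!: exI[of _ "\<lambda>_. 0"])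
  show "p + q \<in> poly_space M" if pq: "p \<in> poly_space M" "q \<in> poly_space M" for p q :: "real^'a \<Rightarrow> real"
  proof -
    from pq obtain c d where "p = (\<lambda>x. \<Sum>\<alpha>\<in>multi_indices M. c \<alpha> * (\<Prod>i\<in>UNIV. (x $ i) ^ \<alpha> i))"
      "q = (\<lambda>x. \<Sum>\<alpha>\<in>multi_indices M. d \<alpha> * (\<Prod>i\<in>UNIV. (x $ i) ^ \<alpha> i))"
      by (auto simp: poly_space_def)
    then have "p + q = (\<lambda>x. \<Sum>\<alpha>\<in>multi_indices M. (c \<alpha> + d \<alpha>) * (\<Prod>i\<in>UNIV. (x $ i) ^ \<alpha> i))"
      by (auto simp: fun_eq_iff distrib_right sum.distrib)
    then show ?thesis by (auto simp: poly_space_def)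
  qed
  show "r *\<^sub>R p \<in> poly_space M" if p: "p \<in> poly_space M" for r and p :: "real^'a \<Rightarrow> real"
  proof -
    from p obtain c where "p = (\<lambda>x. \<Sum>\<alpha>\<in>multi_indices M. c \<alpha> * (\<Prod>i\<in>UNIV. (x $ i) ^ \<alpha> i))"
      by (auto simp: poly_space_def)
    then have "r *\<^sub>R p = (\<lambda>x. \<Sum>\<alpha>\<in>multi_indices M. (r * c \<alpha>) * (\<Prod>i\<in>UNIV. (x $ i) ^ \<alpha> i))"
      by (auto simp: fun_eq_iff sum_distrib_left mult.assoc)
    then show ?thesis by (auto simp: poly_space_def)
  qed
qed

lemma subspace_poly_space0: "subspace (poly_space0 \<Omega> M)"
  using subspace_poly_space[of M]
  by (auto simp: poly_space0_def subspace_def)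

text \<open>
  A definition by sums of arbitrary length is inconvenient; as a span, the tensor product is at once a
  subspace.
\<close>
lemma tensor_space_eq_span:
  "tensor_space \<Omega> M N =
    span {(\<lambda>t x. p x * poly q t) | p q. p \<in> poly_space0 \<Omega> M \<and> degree q \<le> N}"
  (is "_ = span ?G")
proof (intro equalityI subsetI)
  fix v assume "v \<in> tensor_space \<Omega> M N"
  then obtain m :: nat and p q where pq: "\<forall>j<m. p j \<in> poly_space0 \<Omega> M \<and> degree (q j) \<le> N"
    and v: "v = (\<lambda>t x. \<Sum>j<m. p j x * poly (q j) t)" by (auto simp: tensor_space_def)
  have "v = (\<Sum>j<m. (\<lambda>t x. p j x * poly (q j) t))"
    by (simp add: v fun_eq_iff fun_sum_apply)
  also have "\<dots> \<in> span ?G" using pq by (intro span_sum span_base) auto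
  finally show "v \<in> span ?G" .
next
  fix v assume "v \<in> span ?G"
  then show "v \<in> tensor_space \<Omega> M N"
  proof (induction rule: span_induct_alt)
    case base
    show ?case by (auto simp: tensor_space_def fun_eq_iff intro!: exI[of _ "0::nat"])
  next
    case (step c x y)
    then obtain p0 q0 where x: "x = (\<lambda>t x. p0 x * poly q0 t)" "p0 \<in> poly_space0 \<Omega> M" "degree q0 \<le> N"
      by blast
    from step obtain m :: nat and p q where pq: "\<forall>j<m. p j \<in> poly_space0 \<Omega> M \<and> degree (q j) \<le> N"
      and y: "y = (\<lambda>t x. \<Sum>j<m. p j x * poly (q j) t)" by (auto simp: tensor_space_def)
    have "c *\<^sub>R x + y = (\<lambda>t x. \<Sum>j<Suc m. (p(m := p0)) j x * poly ((q(m := smult c q0)) j) t)"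
      by (auto simp: x y fun_eq_iff intro!: sum.cong)
    moreover have "\<forall>j<Suc m. (p(m := p0)) j \<in> poly_space0 \<Omega> M \<and> degree ((q(m := smult c q0)) j) \<le> N"
      using pq x by (auto simp: less_Suc_eq)
    ultimately show ?case unfolding tensor_space_def by blast
  qed
qed

lemma subspace_tensor_space: "subspace (tensor_space \<Omega> M N)"
  by (simp add: tensor_space_eq_span)

lemma tensor_space_subset_finite_span:
  "\<exists>B. finite B \<and> tensor_space \<Omega> M N \<subseteq> span B"
proof (intro exI conjI)
  define b :: "('a \<Rightarrow> nat) \<Rightarrow> nat \<Rightarrow> real \<Rightarrow> real^'a \<Rightarrow> real"
    where "b \<alpha> k = (\<lambda>t x. (\<Prod>i\<in>UNIV. (x $ i) ^ \<alpha> i) * t ^ k)" for \<alpha> k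
  define B where "B = (\<lambda>(\<alpha>, k). b \<alpha> k) ` (multi_indices M \<times> {..N})"
  show "finite B" by (simp add: B_def finite_multi_indices)
  show "tensor_space \<Omega> M N \<subseteq> span B"
    unfolding tensor_space_eq_span
  proof (rule span_minimal[OF _ subspace_span], safe)
    fix p :: "real^'a \<Rightarrow> real" and q :: "real poly"
    assume p: "p \<in> poly_space0 \<Omega> M" and q: "degree q \<le> N"
    then obtain c where p: "p = (\<lambda>x. \<Sum>\<alpha>\<in>multi_indices M. c \<alpha> * (\<Prod>i\<in>UNIV. (x $ i) ^ \<alpha> i))"
      by (auto simp: poly_space0_def poly_space_def)
    have "poly q t = (\<Sum>k\<le>N. coeff q k * t ^ k)" for t
      by (subst poly_as_sum_of_monoms'[OF q, symmetric]) (simp add: poly_sum poly_monom)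
    then have "(\<lambda>t x. p x * poly q t) = (\<Sum>\<alpha>\<in>multi_indices M. \<Sum>k\<le>N. (c \<alpha> * coeff q k) *\<^sub>R b \<alpha> k)"
      by (simp add: p b_def fun_eq_iff fun_sum_apply sum_product mult_ac) (intro allI sum.swap)
    also have "\<dots> \<in> span B"
      by (intro span_sum span_scale span_base) (auto simp: B_def)
    finally show "(\<lambda>t x. p x * poly q t) \<in> span B" .
  qed
qed

text \<open>
  All analytic facts about space-time polynomials follow from one explicit representation
  \<open>v t x = (\<Sum>j<m. p j x * poly (q j) t)\<close>: time derivatives act on the \<open>q j\<close> and gradients on the
  \<open>p j\<close>, so the two commute.
\<close>
lemma tensor_space_regularity:
  assumes "v \<in> tensor_space \<Omega> M N"
  shows has_time_deriv: "((\<lambda>r. v r x) has_real_derivative time_deriv v t x) (at t)"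
    and time_deriv_tensor_space: "time_deriv v \<in> tensor_space \<Omega> M N"
    and has_grad: "GDERIV (v t) x :> grad (v t) x"
    and has_time_deriv_grad:
      "((\<lambda>r. grad (v r) x) has_vector_derivative grad (time_deriv v t) x) (at t)"
    and continuous_tensor: "jointly_continuous v"
    and continuous_grad_tensor: "jointly_continuous (\<lambda>t. grad (v t))"
    and tensor_time_polynomial: "\<exists>Q. \<forall>r. v r x = poly Q r"
    and tensor_slice: "v t \<in> poly_space0 \<Omega> M"
proof -
  obtain m :: nat and p q where pq: "\<And>j. j < m \<Longrightarrow> p j \<in> poly_space0 \<Omega> M"
      "\<And>j. j < m \<Longrightarrow> degree (q j) \<le> N"
    and v: "v = (\<lambda>t x. \<Sum>j<m. p j x * poly (q j) t)"
    using assms by (auto simp: tensor_space_def)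
  have p: "p j \<in> poly_space M" if "j < m" for j using pq that by (auto simp: poly_space0_def)
  have D: "((\<lambda>r. v r x) has_real_derivative (\<Sum>j<m. p j x * poly (pderiv (q j)) t)) (at t)" for t x
    unfolding v by (intro DERIV_sum DERIV_cmult poly_DERIV)
  have td: "time_deriv v = (\<lambda>t x. \<Sum>j<m. p j x * poly (pderiv (q j)) t)"
    unfolding time_deriv_def by (intro ext DERIV_imp_deriv D)
  show "((\<lambda>r. v r x) has_real_derivative time_deriv v t x) (at t)" using D by (simp add: td)
  show "time_deriv v \<in> tensor_space \<Omega> M N"
    unfolding tensor_space_def td using pq
    by (intro CollectI exI[of _ m] exI[of _ p] exI[of _ "\<lambda>j. pderiv (q j)"])
      (auto simp: degree_pderiv intro: order_trans[OF diff_le_self])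
  have G: "GDERIV (\<lambda>x. \<Sum>j<m. p j x * c j) x :> (\<Sum>j<m. c j *\<^sub>R grad (p j) x)" for c x
  proof -
    have "GDERIV (\<lambda>x. \<Sum>j<k. p j x * c j) x :> (\<Sum>j<k. c j *\<^sub>R grad (p j) x)" if "k \<le> m" for k
      using that
    proof (induction k)
      case (Suc k)
      have "GDERIV (\<lambda>x. p k x * c k) x :> c k *\<^sub>R grad (p k) x"
        using GDERIV_mult[OF GDERIV_poly_space[OF p[of k]] GDERIV_const] Suc.prems by simp
      then show ?case using Suc by (simp add: GDERIV_add)
    qed (simp add: GDERIV_const)
    then show ?thesis by simp
  qed
  have gv: "grad (v t) x = (\<Sum>j<m. poly (q j) t *\<^sub>R grad (p j) x)" for t x
    unfolding v by (rule grad_eqI[OF G])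
  have gtd: "grad (time_deriv v t) x = (\<Sum>j<m. poly (pderiv (q j)) t *\<^sub>R grad (p j) x)" for t x
    unfolding td by (rule grad_eqI[OF G])
  show "GDERIV (v t) x :> grad (v t) x" unfolding gv unfolding v by (rule G)
  show "((\<lambda>r. grad (v r) x) has_vector_derivative grad (time_deriv v t) x) (at t)"
    unfolding gv gtd
    using has_vector_derivative_scaleR[OF poly_DERIV has_vector_derivative_const]
    by (intro has_vector_derivative_sum) simp
  have comp: "continuous_on UNIV (\<lambda>z::real \<times> (real^'a). h (snd z))" if "continuous_on UNIV h"
    for h :: "real^'a \<Rightarrow> 'c::topological_space"
    by (rule continuous_on_compose2[OF that]) (auto intro: continuous_intros)
  show "jointly_continuous v"
    unfolding v using p by (auto intro!: continuous_intros comp poly_space_continuous)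
  show "jointly_continuous (\<lambda>t. grad (v t))"
    unfolding gv using p by (auto intro!: continuous_intros comp continuous_grad_poly_space)
  show "\<exists>Q. \<forall>r. v r x = poly Q r"
    by (rule exI[of _ "\<Sum>j<m. smult (p j x) (q j)"]) (simp add: v poly_sum)
  have "v t = (\<Sum>j<m. poly (q j) t *\<^sub>R p j)"
    by (simp add: v fun_eq_iff fun_sum_apply mult.commute)
  then show "v t \<in> poly_space0 \<Omega> M"
    using pq subspace_poly_space0 by (auto intro!: subspace_sum subspace_scale)
qed

lemma tensor_add:
  assumes v: "v \<in> tensor_space \<Omega> M N" and w: "w \<in> tensor_space \<Omega> M N"
  shows time_deriv_add: "time_deriv (v + w) = time_deriv v + time_deriv w"
    and grad_add: "grad ((v + w) t) x = grad (v t) x + grad (w t) x"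
proof -
  have "deriv (\<lambda>r. v r x + w r x) t = time_deriv v t x + time_deriv w t x" for t x
    by (intro DERIV_imp_deriv DERIV_add has_time_deriv[OF v] has_time_deriv[OF w])
  then show "time_deriv (v + w) = time_deriv v + time_deriv w"
    by (simp add: fun_eq_iff time_deriv_def[of "v + w"])
  show "grad ((v + w) t) x = grad (v t) x + grad (w t) x"
    using GDERIV_add[OF has_grad[OF v] has_grad[OF w]]
    by (intro grad_eqI) (simp add: plus_fun_def)
qed

lemma tensor_scaleR:
  assumes v: "v \<in> tensor_space \<Omega> M N"
  shows time_deriv_scaleR: "time_deriv (r *\<^sub>R v) = r *\<^sub>R time_deriv v"
    and grad_scaleR: "grad ((r *\<^sub>R v) t) x = r *\<^sub>R grad (v t) x"
proof -
  have "deriv (\<lambda>s. r * v s x) t = r * time_deriv v t x" for t x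
    by (intro DERIV_imp_deriv DERIV_cmult has_time_deriv[OF v])
  then show "time_deriv (r *\<^sub>R v) = r *\<^sub>R time_deriv v"
    by (simp add: fun_eq_iff time_deriv_def[of "r *\<^sub>R v"])
  have "GDERIV (\<lambda>x. r * v t x) x :> r *\<^sub>R grad (v t) x"
    using GDERIV_mult[OF GDERIV_const has_grad[OF v]] by simp
  then show "grad ((r *\<^sub>R v) t) x = r *\<^sub>R grad (v t) x"
    by (intro grad_eqI) (simp add: scaleR_fun_def)
qed

lemma has_real_derivative_half_norm_sq:
  fixes G :: "real \<Rightarrow> 'b::real_inner"
  assumes "(G has_vector_derivative G') (at t)"
  shows "((\<lambda>r. (norm (G r))\<^sup>2 / 2) has_real_derivative G t \<bullet> G') (at t)"
  using assms
  unfolding power2_norm_eq_inner has_vector_derivative_def has_field_derivative_def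
  by (auto intro!: derivative_eq_intros simp: inner_commute)

section \<open>The space-time Galerkin problem\<close>

text \<open>
  One time step. Here \<open>K\<close> is a Lipschitz constant of \<open>f\<close>, and \<open>small_step\<close> is what the restriction
  \<open>\<tau> \<le> \<epsilon> / L\<close> gives when \<open>K < L\<close>.
\<close>
locale galerkin = cylinder s T \<Omega>
  for s T :: real and \<Omega> :: "(real ^ 'd) set" +
  fixes M N :: nat and u :: "real ^ 'd \<Rightarrow> real" and \<epsilon> K :: real and f :: "real \<Rightarrow> real"
  assumes nonempty: "\<Omega> \<noteq> {}" and eps: "\<epsilon> > 0"
    and f_Lipschitz: "\<And>y z. \<bar>f y - f z\<bar> \<le> K * \<bar>y - z\<bar>"
    and small_step: "K * (T - s) < \<epsilon>"
    and u: "u \<in> poly_space0 \<Omega> M"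
begin

abbreviation X where "X \<equiv> tensor_space \<Omega> M N"

text \<open>
  The increments: the trial space is the translate of this linear space by the polynomial \<open>u\<close>,
  extended constantly in time.
\<close>
definition V where "V = trial_space \<Omega> M N s (\<lambda>x. 0)"

text \<open>
  Test functions enter the problem only through their time derivatives, so the natural inner product
  on increments is the one of the time derivatives.
\<close>
definition ip where "ip v w = J (\<lambda>t x. time_deriv v t x * time_deriv w t x)"

definition residual where
  "residual h v = J (\<lambda>t x. time_deriv h t x * time_deriv v t x
     + \<epsilon> * (grad (h t) x \<bullet> grad (time_deriv v t) x)
     + 1 / \<epsilon> * (f (h t x) * time_deriv v t x))"

lemma eps_neq [simp]: "\<epsilon> \<noteq> 0"
  using eps by simp

lemma VX: "v \<in> V \<Longrightarrow> v \<in> X" and V_initial: "v \<in> V \<Longrightarrow> x \<in> \<Omega> \<Longrightarrow> v s x = 0"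
  by (auto simp: V_def trial_space_def)

lemma subspace_V: "subspace V"
  using subspace_tensor_space[of \<Omega> M N] by (auto simp: V_def trial_space_def subspace_def)

lemma finite_basis: "\<exists>B. finite B \<and> span B = V"
proof -
  obtain S :: "(real \<Rightarrow> real^'d \<Rightarrow> real) set" where S: "finite S" "X \<subseteq> span S"
    using tensor_space_subset_finite_span by blast
  obtain B where B: "B \<subseteq> V" "independent B" "V \<subseteq> span B" using maximal_independent_subset by blast
  have "B \<subseteq> span S" using S VX B by blast
  then have "finite B" using independent_span_bound[OF S(1) B(2)] by blast
  moreover have "span B = V" using B span_minimal[OF B(1) subspace_V] by blast
  ultimately show ?thesis by blast
qed

lemma K_nonneg: "K \<ge> 0"
  using f_Lipschitz[of 1 0] by (simp add: order_trans[OF abs_ge_zero])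

lemma stationary_in_X: "(\<lambda>t. u) \<in> X"
  using u unfolding tensor_space_def
  by (intro CollectI exI[of _ "1::nat"] exI[of _ "\<lambda>_. u"] exI[of _ "\<lambda>_. 1"]) auto

lemma trial_space_eq: "trial_space \<Omega> M N s u = (\<lambda>w. (\<lambda>t. u) + w) ` V"
proof (intro equalityI subsetI)
  fix h assume h: "h \<in> trial_space \<Omega> M N s u"
  then have "h - (\<lambda>t. u) \<in> V"
    using subspace_diff[OF subspace_tensor_space _ stationary_in_X] by (auto simp: V_def trial_space_def)
  then show "h \<in> (\<lambda>w. (\<lambda>t. u) + w) ` V" by (intro image_eqI[of _ _ "h - (\<lambda>t. u)"]) auto
next
  fix h assume "h \<in> (\<lambda>w. (\<lambda>t. u) + w) ` V"
  then show "h \<in> trial_space \<Omega> M N s u"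
    using subspace_add[OF subspace_tensor_space stationary_in_X]
    by (auto simp: V_def trial_space_def)
qed

lemma time_deriv_stationary: "time_deriv (\<lambda>t. u) = 0"
  by (simp add: time_deriv_def fun_eq_iff)

lemma time_deriv_trial: "w \<in> X \<Longrightarrow> time_deriv ((\<lambda>t. u) + w) = time_deriv w"
  using time_deriv_add[OF stationary_in_X, of w] by (simp add: time_deriv_stationary)

lemma f_continuous: "continuous_on UNIV f"
  by (rule lipschitz_on_continuous_on[of K])
    (auto intro!: lipschitz_onI simp: dist_real_def f_Lipschitz K_nonneg)

lemma joint_continuity:
  assumes "v \<in> X"
  shows cont: "jointly_continuous v"
    and cont_t: "jointly_continuous (time_deriv v)"
    and cont_grad: "jointly_continuous (\<lambda>t. grad (v t))"
    and cont_grad_t: "jointly_continuous (\<lambda>t. grad (time_deriv v t))"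
    and cont_f: "jointly_continuous (\<lambda>t x. f (v t x))"
  using assms time_deriv_tensor_space[OF assms]
  by (auto intro: continuous_tensor continuous_grad_tensor continuous_on_compose2[OF f_continuous])

lemmas cont_rules = continuous_intros cont_t cont_grad cont_grad_t cont_f

lemma galerkin_form_eq_residual:
  assumes "h \<in> X" "v \<in> X"
  shows "(LINT r:{s..T}|lborel.
             L2_inner \<Omega> (time_deriv h r) (time_deriv v r)
           + \<epsilon> * L2_inner \<Omega> (grad (h r)) (grad (time_deriv v r))
           + 1 / \<epsilon> * L2_inner \<Omega> (\<lambda>x. f (h r x)) (time_deriv v r)) = residual h v"
proof -
  have c: "jointly_continuous (\<lambda>t x. time_deriv h t x * time_deriv v t x)"
    "jointly_continuous (\<lambda>t x. \<epsilon> * (grad (h t) x \<bullet> grad (time_deriv v t) x))"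
    "jointly_continuous (\<lambda>t x. 1 / \<epsilon> * (f (h t x) * time_deriv v t x))"
    using assms by (auto intro!: cont_rules)
  have int: "set_integrable lborel \<Omega> (g t)" if "jointly_continuous g" for g :: "real \<Rightarrow> real^'d \<Rightarrow> real" and t
    using bounded open_dom jointly_continuous_space_slice[OF that]
    by (intro set_integrable_continuous_on_bounded) auto
  have "L2_inner \<Omega> (time_deriv h t) (time_deriv v t)
           + \<epsilon> * L2_inner \<Omega> (grad (h t)) (grad (time_deriv v t))
           + 1 / \<epsilon> * L2_inner \<Omega> (\<lambda>x. f (h t x)) (time_deriv v t)
    = (LINT x:\<Omega>|lborel. time_deriv h t x * time_deriv v t x
     + \<epsilon> * (grad (h t) x \<bullet> grad (time_deriv v t) x)
     + 1 / \<epsilon> * (f (h t x) * time_deriv v t x))" for t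
    using int[OF c(1), of t] int[OF c(2), of t] int[OF c(3), of t]
    by (simp only: L2_inner_def inner_real_def set_integral_mult_right[symmetric] set_integral_add)
  then show ?thesis
    unfolding residual_def using c by (subst J_time_space) (auto intro!: continuous_intros)
qed

text \<open>
  Definiteness of the inner product. A vanishing time derivative and zero initial values give \<open>w = 0\<close>
  on the cylinder; identity theorems for polynomials, first in time and then in space, extend this to
  all arguments.
\<close>
lemma vanishing_time_deriv:
  assumes w: "w \<in> V" and zero: "J (\<lambda>t x. (time_deriv w t x)\<^sup>2) = 0"
  shows "w = 0"
proof -
  have td: "time_deriv w t x = 0" if "s < t" "t < T" "x \<in> \<Omega>" for t x
  proof -
    have "jointly_continuous (\<lambda>t x. (time_deriv w t x)\<^sup>2)"
      by (intro continuous_intros cont_t VX w)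
    from J_eq_0D[OF this _ zero that] show ?thesis by simp
  qed
  have w0: "w t x = 0" if x: "x \<in> \<Omega>" for t x
  proof -
    have "w t x = w s x" if "t \<in> {s..T}" for t
    proof (rule DERIV_isconst2[of s T])
      show "continuous_on {s..T} (\<lambda>t. w t x)"
        using jointly_continuous_time_slice[OF cont[OF VX[OF w]]] continuous_on_subset by blast
      show "((\<lambda>t. w t x) has_real_derivative 0) (at r)" if "s < r" "r < T" for r
        using has_time_deriv[OF VX[OF w], of x r] td[OF that x] by simp
    qed (use time that in auto)
    then have *: "w t x = 0" if "t \<in> {s..T}" for t using that V_initial[OF w x] by simp
    obtain Q where Q: "\<And>r. w r x = poly Q r" using tensor_time_polynomial[OF VX[OF w]] by blast
    then have "{s..T} \<subseteq> {r. poly Q r = 0}" using * by auto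
    then have "infinite {r. poly Q r = 0}" using time infinite_Icc finite_subset by blast
    then have "Q = 0" using poly_roots_finite by blast
    then show ?thesis using Q by simp
  qed
  have "w t x = 0" for t x
  proof (rule poly_space_eq_0_of_open)
    show "w t \<in> poly_space M" using tensor_slice[OF VX[OF w], of t] by (simp add: poly_space0_def)
  qed (use open_dom nonempty w0 in auto)
  then show ?thesis by (auto simp: fun_eq_iff)
qed

sublocale inner_product_on V ip
proof
  fix a b c :: "real \<Rightarrow> real^'d \<Rightarrow> real" and r :: real
  show "subspace V" by (rule subspace_V)
  show "ip (a + b) c = ip a c + ip b c" if "a \<in> V" "b \<in> V" "c \<in> V"
    using that[THEN VX]
    by (simp add: ip_def time_deriv_add distrib_right J_add cont_rules)
  show "ip (r *\<^sub>R a) c = r * ip a c" if "a \<in> V" "c \<in> V"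
    using that[THEN VX] by (simp add: ip_def time_deriv_scaleR mult.assoc J_cmult)
  show "ip a b = ip b a" by (simp add: ip_def mult.commute)
  show "0 \<le> ip a a" by (simp add: ip_def J_nonneg)
  show "a = 0" if "a \<in> V" "ip a a = 0"
    using that vanishing_time_deriv[of a] by (simp add: ip_def power2_eq_square)
qed

lemma J_time_deriv_sq: "v \<in> V \<Longrightarrow> J (\<lambda>t x. (time_deriv v t x)\<^sup>2) = (nrm v)\<^sup>2"
  by (simp add: nrm_sq) (simp add: ip_def power2_eq_square)

text \<open>
  Since \<open>a\<close> starts from zero, the Poincare inequality in time bounds its norm by that of its time
  derivative; the Cauchy--Schwarz inequality does the rest. This is the whole cost of the nonlinearity.
\<close>
lemma J_product_le:
  assumes a: "a \<in> V" and b: "b \<in> V"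
  shows "J (\<lambda>t x. \<bar>a t x * time_deriv b t x\<bar>) \<le> (T - s) * (nrm a * nrm b)"
proof -
  have "J (\<lambda>t x. (a t x)\<^sup>2) \<le> (T - s)\<^sup>2 * J (\<lambda>t x. (time_deriv a t x)\<^sup>2)"
    using VX[OF a] V_initial[OF a]
    by (intro J_time_Poincare cont cont_t has_time_deriv) auto
  then have "sqrt (J (\<lambda>t x. (a t x)\<^sup>2)) \<le> (T - s) * nrm a"
    using time nrm_nonneg[OF a]
    by (intro real_le_lsqrt) (simp_all add: J_time_deriv_sq[OF a] power_mult_distrib)
  moreover have "sqrt (J (\<lambda>t x. (time_deriv b t x)\<^sup>2)) = nrm b"
    by (simp add: J_time_deriv_sq[OF b] nrm_nonneg[OF b])
  moreover have "J (\<lambda>t x. \<bar>a t x * time_deriv b t x\<bar>)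
      \<le> sqrt (J (\<lambda>t x. (a t x)\<^sup>2)) * sqrt (J (\<lambda>t x. (time_deriv b t x)\<^sup>2))"
    using VX[OF a] VX[OF b] by (intro J_Cauchy_Schwarz cont cont_t)
  ultimately show ?thesis
    using nrm_nonneg[OF b] mult_right_mono[of _ _ "nrm b"] by (fastforce simp: mult.assoc)
qed

text \<open>
  The integrand is the time derivative of \<open>(norm (grad (v t) x))\<^sup>2 / 2\<close>, and an increment starts from
  zero, so only the contribution of the final time remains.
\<close>
lemma J_grad_nonneg:
  assumes "v \<in> V"
  shows "0 \<le> J (\<lambda>t x. grad (v t) x \<bullet> grad (time_deriv v t) x)"
proof -
  note vX = VX[OF assms]
  have s0: "grad (v s) x = 0" if "x \<in> \<Omega>" for x
  proof -
    have "v s y = 0" for y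
    proof (rule poly_space_eq_0_of_open)
      show "v s \<in> poly_space M" using tensor_slice[OF vX] by (simp add: poly_space0_def)
    qed (use open_dom nonempty V_initial[OF assms] in auto)
    then have "v s = (\<lambda>x. 0)" by auto
    then show ?thesis by (simp add: grad_eqI GDERIV_const)
  qed
  have "J (\<lambda>t x. grad (v t) x \<bullet> grad (time_deriv v t) x)
     = (LINT x:\<Omega>|lborel. (norm (grad (v T) x))\<^sup>2 / 2 - (norm (grad (v s) x))\<^sup>2 / 2)"
  proof (rule J_FTC)
    show "jointly_continuous (\<lambda>t x. grad (v t) x \<bullet> grad (time_deriv v t) x)"
      using vX by (auto intro!: cont_rules)
    fix t x
    show "((\<lambda>r. (norm (grad (v r) x))\<^sup>2 / 2) has_real_derivative
        grad (v t) x \<bullet> grad (time_deriv v t) x) (at t)"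
      by (rule has_real_derivative_half_norm_sq[OF has_time_deriv_grad[OF vX]])
  qed
  also have "\<dots> = (LINT x:\<Omega>|lborel. (norm (grad (v T) x))\<^sup>2 / 2)"
    using open_dom by (intro set_lebesgue_integral_cong) (auto simp: s0)
  also have "\<dots> \<ge> 0"
    unfolding set_lebesgue_integral_def by (intro Bochner_Integration.integral_nonneg) simp
  finally show ?thesis .
qed

lemma residual_add: 
  assumes "h \<in> X" "v \<in> X" "w \<in> X"
  shows "residual h (v + w) = residual h v + residual h w"
proof -
  note td = time_deriv_tensor_space
  show ?thesis
    unfolding residual_def
    using assms grad_add[OF td[OF assms(2)] td[OF assms(3)]]
    by (subst J_add[symmetric])
       (auto intro!: cont_rules simp: time_deriv_add inner_add_right algebra_simps)
qed

lemma residual_scaleR: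
  assumes "h \<in> X" "v \<in> X"
  shows "residual h (r *\<^sub>R v) = r * residual h v"
  unfolding residual_def J_cmult[symmetric]
  using assms grad_scaleR[OF time_deriv_tensor_space[OF assms(2)]]
  by (auto simp: time_deriv_scaleR algebra_simps)

text \<open>
  The difference of two residuals is a bilinear part plus the contribution of \<open>f\<close>, and the latter is
  bounded in the norm of the time derivatives. This one estimate gives both the strong monotonicity and
  the Lipschitz continuity of the residual.
\<close>
lemma residual_diff:
  assumes h: "h \<in> X" "h' \<in> X" and d: "h - h' \<in> V" and v: "v \<in> V"
  defines "e \<equiv> residual h v - residual h' v
      - ip (h - h') v - \<epsilon> * J (\<lambda>t x. grad ((h - h') t) x \<bullet> grad (time_deriv v t) x)"
  shows "\<bar>e\<bar> \<le> K / \<epsilon> * ((T - s) * (nrm (h - h') * nrm v))"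
proof -
  define D where "D = h - h'"
  have X: "D \<in> X" "v \<in> X" and DV: "D \<in> V" using d v VX by (auto simp: D_def)
  have hD: "h = h' + D" by (simp add: D_def)
  have td: "time_deriv h = time_deriv h' + time_deriv D"
    and gr: "grad (h t) x = grad (h' t) x + grad (D t) x" for t x
    unfolding hD by (rule time_deriv_add[OF h(2) X(1)], rule grad_add[OF h(2) X(1)])
  let ?g = "\<lambda>t x. (f (h t x) - f (h' t x)) * time_deriv v t x"
  have "residual h v - residual h' v = J (\<lambda>t x. time_deriv D t x * time_deriv v t x
     + \<epsilon> * (grad (D t) x \<bullet> grad (time_deriv v t) x) + 1 / \<epsilon> * ?g t x)"
    unfolding residual_def using h X
    by (subst J_diff[symmetric])
      (auto intro!: cont_rules simp: td gr inner_add_left algebra_simps)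
  also have "\<dots> = ip D v + \<epsilon> * J (\<lambda>t x. grad (D t) x \<bullet> grad (time_deriv v t) x) + 1 / \<epsilon> * J ?g"
    unfolding ip_def J_cmult[symmetric] using h X
    by (subst J_add[symmetric], (auto intro!: cont_rules)[2])+ simp
  finally have e: "e = 1 / \<epsilon> * J ?g" by (simp add: e_def D_def)
  have "\<bar>J ?g\<bar> \<le> J (\<lambda>t x. \<bar>?g t x\<bar>)"
    using h X by (intro J_abs) (auto intro!: cont_rules)
  also have "\<dots> \<le> J (\<lambda>t x. K * \<bar>D t x * time_deriv v t x\<bar>)"
  proof (rule J_mono)
    fix t x
    show "\<bar>?g t x\<bar> \<le> K * \<bar>D t x * time_deriv v t x\<bar>"
      using mult_right_mono[OF f_Lipschitz[of "h t x" "h' t x"], of "\<bar>time_deriv v t x\<bar>"]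
      by (simp add: abs_mult D_def mult.assoc)
  qed (use h X cont[OF X(1)] in \<open>auto intro!: cont_rules\<close>)
  also have "\<dots> \<le> K * ((T - s) * (nrm D * nrm v))"
    unfolding J_cmult by (intro mult_left_mono J_product_le DV v K_nonneg)
  finally show ?thesis using eps by (simp add: e abs_mult D_def[symmetric] field_simps)
qed

text \<open>
  Tested with the difference itself, the first term is the full squared norm, the gradient term has the
  good sign, and the nonlinearity costs at most the fraction \<open>K * (T - s) / \<epsilon> < 1\<close>.
\<close>
lemma residual_strongly_monotone:
  assumes h: "h \<in> X" "h' \<in> X" and d: "h - h' \<in> V"
  shows "(1 - K * (T - s) / \<epsilon>) * (nrm (h - h'))\<^sup>2 \<le> residual h (h - h') - residual h' (h - h')"
proof -
  have "0 \<le> \<epsilon> * J (\<lambda>t x. grad ((h - h') t) x \<bullet> grad (time_deriv (h - h') t) x)"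
    using J_grad_nonneg[OF d] eps by (intro mult_nonneg_nonneg) auto
  moreover have "- (K / \<epsilon> * ((T - s) * (nrm (h - h') * nrm (h - h'))))
      \<le> residual h (h - h') - residual h' (h - h') - ip (h - h') (h - h')
        - \<epsilon> * J (\<lambda>t x. grad ((h - h') t) x \<bullet> grad (time_deriv (h - h') t) x)"
    using residual_diff[OF h d d] by linarith
  moreover have "K / \<epsilon> * ((T - s) * (nrm (h - h') * nrm (h - h'))) = K * (T - s) / \<epsilon> * (nrm (h - h'))\<^sup>2"
    by (simp add: power2_eq_square)
  ultimately show ?thesis
    unfolding left_diff_distrib using nrm_sq[OF d] by linarith
qed

text \<open>
  The gradient term is a linear functional of the difference, hence bounded in the norm of the
  time derivatives, although that norm contains no spatial gradient, because \<open>V\<close> is finite-dimensional.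
\<close>
lemma residual_Lipschitz:
  assumes v: "v \<in> V"
  shows "\<exists>\<Lambda>. \<forall>h\<in>X. \<forall>h'\<in>X. h - h' \<in> V \<longrightarrow> \<bar>residual h v - residual h' v\<bar> \<le> \<Lambda> * nrm (h - h')"
proof -
  obtain B where B: "finite B" "span B = V" using finite_basis by blast
  let ?l = "\<lambda>D. J (\<lambda>t x. grad (D t) x \<bullet> grad (time_deriv v t) x)"
  have "\<exists>C. \<forall>a\<in>V. \<bar>?l a\<bar> \<le> C * nrm a"
  proof (rule linear_functional_bounded[OF B])
    fix a b and r :: real assume a: "a \<in> V"
    show "?l (r *\<^sub>R a) = r * ?l a"
      by (simp add: grad_scaleR[OF VX[OF a], simplified] J_cmult)
    assume b: "b \<in> V"
    show "?l (a + b) = ?l a + ?l b"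
      unfolding grad_add[OF VX[OF a] VX[OF b]] inner_add_left
      using VX[OF a] VX[OF b] VX[OF v] by (intro J_add) (auto intro!: cont_rules)
  qed
  then obtain C where C: "\<And>a. a \<in> V \<Longrightarrow> \<bar>?l a\<bar> \<le> C * nrm a" by blast
  have "\<bar>residual h v - residual h' v\<bar> \<le> (nrm v + \<epsilon> * C + K / \<epsilon> * (T - s) * nrm v) * nrm (h - h')"
    if h: "h \<in> X" "h' \<in> X" and d: "h - h' \<in> V" for h h'
  proof -
    have "\<bar>ip (h - h') v\<bar> \<le> nrm v * nrm (h - h')"
      using Cauchy_Schwarz_nrm[OF d v] by (simp add: mult.commute)
    moreover have "\<bar>\<epsilon> * ?l (h - h')\<bar> \<le> \<epsilon> * C * nrm (h - h')"
      using mult_left_mono[OF C[OF d], of \<epsilon>] eps by (simp add: abs_mult mult.assoc)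
    moreover have "K / \<epsilon> * ((T - s) * (nrm (h - h') * nrm v)) = K / \<epsilon> * (T - s) * nrm v * nrm (h - h')"
      by (simp add: mult_ac)
    ultimately show ?thesis
      using residual_diff[OF h d v] unfolding distrib_right by linarith
  qed
  then show ?thesis by blast
qed

lemma trial_diff: "h \<in> trial_space \<Omega> M N s u \<Longrightarrow> h' \<in> trial_space \<Omega> M N s u \<Longrightarrow> h - h' \<in> V"
  by (auto simp: trial_space_eq)

lemma trial_in_X: "h \<in> trial_space \<Omega> M N s u \<Longrightarrow> h \<in> X"
  by (simp add: trial_space_def)

lemma stationary_plus_in_X: "w \<in> V \<Longrightarrow> (\<lambda>t. u) + w \<in> X"
  by (rule trial_in_X) (simp add: trial_space_eq)

lemma galerkin_solution_iff:
  "galerkin_solution \<epsilon> f \<Omega> M N s T u h \<longleftrightarrow>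
    h \<in> trial_space \<Omega> M N s u \<and> (\<forall>v\<in>V. residual h v = 0)"
proof -
  have "galerkin_solution \<epsilon> f \<Omega> M N s T u h \<longleftrightarrow>
      h \<in> trial_space \<Omega> M N s u \<and> (\<forall>v\<in>trial_space \<Omega> M N s u. residual h v = 0)"
    by (simp only: galerkin_solution_def galerkin_form_eq_residual trial_in_X cong: conj_cong ball_cong)
  moreover have "residual h ((\<lambda>t. u) + w) = residual h w" if "w \<in> V" for w
    using VX[OF that] by (simp add: residual_def time_deriv_trial)
  ultimately show ?thesis by (auto simp: trial_space_eq)
qed

lemma monotonicity_constant_pos: "1 - K * (T - s) / \<epsilon> > 0"
  using small_step eps by simp

theorem unique_solution: "\<exists>!h. galerkin_solution \<epsilon> f \<Omega> M N s T u h"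
proof -
  obtain B where B: "finite B" "span B = V" using finite_basis by blast
  have "\<exists>w\<in>span B. \<forall>a\<in>span B. residual ((\<lambda>t. u) + w) a = 0"
  proof (rule monotone_galerkin_solvable[OF B(1) _ monotonicity_constant_pos])
    note tr = stationary_plus_in_X
    show "B \<subseteq> V" using B span_superset by blast
    fix w w' a b and r :: real assume w: "w \<in> V"
    show "residual ((\<lambda>t. u) + w) (a + b) = residual ((\<lambda>t. u) + w) a + residual ((\<lambda>t. u) + w) b"
      if "a \<in> V" "b \<in> V" by (intro residual_add tr w VX that)
    show "residual ((\<lambda>t. u) + w) (r *\<^sub>R a) = r * residual ((\<lambda>t. u) + w) a" if "a \<in> V"
      by (intro residual_scaleR tr w VX that)
    assume w': "w' \<in> V"
    show "(1 - K * (T - s) / \<epsilon>) * (nrm (w - w'))\<^sup>2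
        \<le> residual ((\<lambda>t. u) + w) (w - w') - residual ((\<lambda>t. u) + w') (w - w')"
      using residual_strongly_monotone[OF tr[OF w] tr[OF w']] w w' by simp
  next
    fix a assume "a \<in> V"
    from residual_Lipschitz[OF this] obtain \<Lambda> where
      "\<forall>h\<in>X. \<forall>h'\<in>X. h - h' \<in> V \<longrightarrow> \<bar>residual h a - residual h' a\<bar> \<le> \<Lambda> * nrm (h - h')"
      by (rule exE)
    note \<Lambda> = this[rule_format]
    have "\<bar>residual ((\<lambda>t. u) + w) a - residual ((\<lambda>t. u) + w') a\<bar> \<le> \<Lambda> * nrm (w - w')"
      if "w \<in> V" "w' \<in> V" for w w'
      using \<Lambda>[OF stationary_plus_in_X[OF that(1)] stationary_plus_in_X[OF that(2)]] that by simp
    then show "\<exists>\<Lambda>. \<forall>w\<in>V. \<forall>w'\<in>V. \<bar>residual ((\<lambda>t. u) + w) a - residual ((\<lambda>t. u) + w') a\<bar> \<le> \<Lambda> * nrm (w - w')"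
      by blast
  qed
  then have ex: "\<exists>h. galerkin_solution \<epsilon> f \<Omega> M N s T u h"
    unfolding galerkin_solution_iff B(2) by (auto simp: trial_space_eq)
  have "h = h'" if "galerkin_solution \<epsilon> f \<Omega> M N s T u h" "galerkin_solution \<epsilon> f \<Omega> M N s T u h'" for h h'
  proof -
    have tr: "h \<in> trial_space \<Omega> M N s u" "h' \<in> trial_space \<Omega> M N s u"
      and zero: "\<And>v. v \<in> V \<Longrightarrow> residual h v = 0 \<and> residual h' v = 0"
      using that by (auto simp: galerkin_solution_iff)
    note d = trial_diff[OF tr]
    have "(1 - K * (T - s) / \<epsilon>) * (nrm (h - h'))\<^sup>2 \<le> 0"
      using residual_strongly_monotone[OF tr[THEN trial_in_X] d] zero[OF d] by simp
    then have "(nrm (h - h'))\<^sup>2 \<le> 0"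
      using monotonicity_constant_pos by (simp only: mult_le_0_iff) auto
    then show "h = h'" using ip_definite[OF d] ip_nonneg[OF d] by (simp add: nrm_sq[OF d])
  qed
  with ex show ?thesis by blast
qed

text \<open>
  The time derivative of \<open>h\<close> is also the time derivative of an increment, so \<open>h\<close> may be used as its own
  test function. The gradient and potential terms then form the time derivative of the energy density.
\<close>
theorem energy_law:
  assumes h: "galerkin_solution \<epsilon> f \<Omega> M N s T u h"
    and F: "\<And>y. (F has_real_derivative f y) (at y)"
  shows "energy \<epsilon> F \<Omega> (h T) - energy \<epsilon> F \<Omega> (h s) =
      - (LINT r:{s..T}|lborel. L2_inner \<Omega> (time_deriv h r) (time_deriv h r))"
proof -
  have tr: "h \<in> trial_space \<Omega> M N s u" using h by (simp add: galerkin_solution_iff)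
  note hX = trial_in_X[OF tr]
  obtain w where w: "w \<in> V" "h = (\<lambda>t. u) + w" using tr by (auto simp: trial_space_eq)
  have td: "time_deriv w = time_deriv h" using w VX time_deriv_trial by simp
  have "residual h w = 0" using h w by (simp add: galerkin_solution_iff)
  then have res: "residual h h = 0" unfolding residual_def td .
  define e where "e t x = \<epsilon> / 2 * (norm (grad (h t) x))\<^sup>2 + 1 / \<epsilon> * F (h t x)" for t x
  let ?e' = "\<lambda>t x. \<epsilon> * (grad (h t) x \<bullet> grad (time_deriv h t) x) + 1 / \<epsilon> * (f (h t x) * time_deriv h t x)"
  let ?tt = "\<lambda>t x. time_deriv h t x * time_deriv h t x"
  have c: "jointly_continuous ?e'" "jointly_continuous ?tt"
    using hX by (auto intro!: cont_rules simp: eps[THEN less_imp_neq, symmetric])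
  have "continuous_on UNIV F" using F DERIV_continuous_on by blast
  then have cF: "jointly_continuous (\<lambda>t x. F (h t x))"
    using cont[OF hX] by (rule continuous_on_compose2) auto
  have ce: "jointly_continuous e"
    unfolding e_def using hX cF by (intro cont_rules) 
  have int: "set_integrable lborel \<Omega> (e t)" for t
    using bounded open_dom jointly_continuous_space_slice[OF ce]
    by (intro set_integrable_continuous_on_bounded) auto
  have "J ?e' = (LINT x:\<Omega>|lborel. e T x - e s x)"
  proof (rule J_FTC[OF c(1)])
    fix t x
    have "((\<lambda>r. (norm (grad (h r) x))\<^sup>2 / 2) has_real_derivative
        grad (h t) x \<bullet> grad (time_deriv h t) x) (at t)"
      by (rule has_real_derivative_half_norm_sq[OF has_time_deriv_grad[OF hX]])
    from DERIV_add[OF DERIV_cmult[OF this, of \<epsilon>]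
        DERIV_cmult[OF DERIV_chain2[OF F has_time_deriv[OF hX]], of "1 / \<epsilon>"]]
    show "((\<lambda>r. e r x) has_real_derivative ?e' t x) (at t)"
      unfolding e_def by simp
  qed
  also have "\<dots> = energy \<epsilon> F \<Omega> (h T) - energy \<epsilon> F \<Omega> (h s)"
    unfolding energy_def e_def[symmetric] by (rule set_integral_diff(2)[OF int int])
  finally have "energy \<epsilon> F \<Omega> (h T) - energy \<epsilon> F \<Omega> (h s) = - J ?tt"
    using res J_add[OF c(2) c(1)] by (simp add: residual_def add.assoc)
  then show ?thesis unfolding J_time_space[OF c(2)] by (simp add: L2_inner_def)
qed

end

theorem theorem1:
  fixes \<Omega> :: "(real ^ 'd) set"
    and F f f' :: "real \<Rightarrow> real"
    and \<epsilon> L \<tau> :: real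
    and M N n :: nat
    and t :: "nat \<Rightarrow> real"
    and u :: "real ^ 'd \<Rightarrow> real"
  assumes domain: "admissible_domain \<Omega>"
    and eps: "\<epsilon> > 0"
    and F_deriv: "\<And>y. (F has_real_derivative f y) (at y)"
    and f_deriv: "\<And>y. (f has_real_derivative f' y) (at y)"
    and f'_bounded: "bdd_above (range (\<lambda>y. \<bar>f' y\<bar>))"
    and f'_less: "(SUP y. \<bar>f' y\<bar>) < L"
    and N: "N \<ge> 1"
    and n: "n \<ge> 1"
    and tau_pos: "\<tau> > 0"
    and grid: "\<And>k. t k = real k * \<tau>"
    and tau_le: "\<tau> \<le> \<epsilon> / L"
    and u: "u \<in> poly_space0 \<Omega> M"
  shows "(\<exists>!h. galerkin_solution \<epsilon> f \<Omega> M N (t (n - 1)) (t n) u h) \<and>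
    (\<forall>h. galerkin_solution \<epsilon> f \<Omega> M N (t (n - 1)) (t n) u h \<longrightarrow>
       energy \<epsilon> F \<Omega> (h (t n)) - energy \<epsilon> F \<Omega> (h (t (n - 1))) =
         - (LINT r:{t (n - 1)..t n}|lborel. L2_inner \<Omega> (time_deriv h r) (time_deriv h r)) \<and>
       - (LINT r:{t (n - 1)..t n}|lborel. L2_inner \<Omega> (time_deriv h r) (time_deriv h r)) \<le> 0)"
proof -
  define s T where "s = t (n - 1)" and "T = t n"
  have step: "T - s = \<tau>"
    using n unfolding s_def T_def grid by (simp add: of_nat_diff algebra_simps)
  have dom: "bounded \<Omega>" "open \<Omega>" "\<Omega> \<noteq> {}"
    using domain by (auto simp: admissible_domain_def bounded_domain_def)
  define K where "K = (SUP y. \<bar>f' y\<bar>)"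
  have f'_le: "\<bar>f' y\<bar> \<le> K" for y
    unfolding K_def by (rule cSUP_upper[OF UNIV_I f'_bounded])
  have f_Lip: "\<bar>f y - f z\<bar> \<le> K * \<bar>y - z\<bar>" for y z
    using field_differentiable_bound[of UNIV f f' K y z] f_deriv f'_le
    by auto
  have "L > 0" using f'_le[of 0] f'_less by (simp add: K_def)
  then have "L * \<tau> \<le> \<epsilon>" using tau_le by (simp add: field_simps)
  moreover have "K * \<tau> < L * \<tau>" using f'_less tau_pos by (simp add: K_def)
  ultimately have small: "K * (T - s) < \<epsilon>" using step by simp
  interpret galerkin s T \<Omega> M N u \<epsilon> K f
    by unfold_locales (use step tau_pos dom eps f_Lip small u in auto)
  have "0 \<le> (LINT r:{s..T}|lborel. L2_inner \<Omega> (time_deriv h r) (time_deriv h r))" for h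
    unfolding L2_inner_def set_lebesgue_integral_def
    by (intro Bochner_Integration.integral_nonneg scaleR_nonneg_nonneg) auto
  then show ?thesis
    using unique_solution energy_law[OF _ F_deriv] unfolding s_def T_def by auto
qed

end
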